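(* Let $\zeta$ be a transcendental real number. Then \[\frac{(\overline{\widehat{w}}(\zeta)+1)^2}{4\overline{\widehat{w}}(\zeta)}\le\overline{\widehat{\lambda}}(\zeta)\le1+\frac{1}{\underline{\widehat{w}}(\zeta)},\qquad \frac{(\underline{\widehat{w}}(\zeta)+1)^2}{4\underline{\widehat{w}}(\zeta)}\le\underline{\widehat{\lambda}}(\zeta)\le1+\frac{1}{\overline{\widehat{w}}(\zeta)},\] and \[\overline{\widehat{w}}(\zeta)\le\min\Big\{2,\overline{w}(\zeta),1+\frac{4}{\underline{w}(\zeta)}\Big\},\qquad \underline{\widehat{w}}(\zeta)\le\min\Big\{2,\underline{w}(\zeta),1+\frac{4}{\overline{w}(\zeta)}\Big\}.\]
   Context: $H(P)$ is the maximum modulus of the coefficients of $P\in\mathbb{Z}[T]$. $w_n(\zeta)$: supremum of $w$ such that $0<|P(\zeta)|\le H(P)^{-w}$ has infinitely many solutions $P\in\mathbb{Z}[T]$ of degree $\le n$; $\widehat{w}_n(\zeta)$: supremum of $w$ such that $H(P)\le X$, $0<|P(\zeta)|\le X^{-w}$ has a solution $P$ of degree $\le n$ for all large $X$. $\widehat{\lambda}_n(\zeta)$: supremum of $\lambda$ such that $1\le|x|\le X$, $\max_{1\le i\le n}|\zeta^ix-y_i|\le X^{-\lambda}$ has an integer solution for all large $X$. Define (limits as $n\to\infty$) $\overline{w}=\limsup w_n/n$, $\underline{w}=\liminf w_n/n$, $\overline{\widehat{w}}=\limsup\widehat{w}_n/n$, $\underline{\widehat{w}}=\liminf\widehat{w}_n/n$,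 $\overline{\widehat{\lambda}}=\limsup n\widehat{\lambda}_n$, $\underline{\widehat{\lambda}}=\liminf n\widehat{\lambda}_n$. Convention: $1/\infty=0$. *)

theory Defs
  imports Complex_Main "HOL-Library.Extended_Real" "HOL-Computational_Algebra.Polynomial"
begin

definition height :: "int poly \<Rightarrow> int" where
  "height P = (MAX i\<in>{..degree P}. \<bar>coeff P i\<bar>)"

definition eval_at :: "int poly \<Rightarrow> real \<Rightarrow> real" where
  "eval_at P \<zeta> = poly (map_poly of_int P) \<zeta>"

text \<open>The exponents are suprema of sets of real numbers taken in the extended reals, since
  \<open>w_exp n \<zeta>\<close> may be infinite.\<close>

definition w_exp :: "nat \<Rightarrow> real \<Rightarrow> ereal" where
  "w_exp n \<zeta> = Sup {ereal w | w.
     infinite {P. degree P \<le> n \<and> 0 < \<bar>eval_at P \<zeta>\<bar> \<and>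
                  \<bar>eval_at P \<zeta>\<bar> \<le> real_of_int (height P) powr (- w)}}"

definition w_hat_exp :: "nat \<Rightarrow> real \<Rightarrow> ereal" where
  "w_hat_exp n \<zeta> = Sup {ereal w | w.
     \<forall>\<^sub>F X :: real in at_top. \<exists>P. degree P \<le> n \<and> real_of_int (height P) \<le> X \<and>
        0 < \<bar>eval_at P \<zeta>\<bar> \<and> \<bar>eval_at P \<zeta>\<bar> \<le> X powr (- w)}"

text \<open>For \<open>n = 0\<close> the maximum below ranges over the empty set and is unspecified; only the
  behaviour as \<open>n \<rightarrow> \<infinity>\<close> is used.\<close>

definition lambda_hat_exp :: "nat \<Rightarrow> real \<Rightarrow> ereal" where
  "lambda_hat_exp n \<zeta> = Sup {ereal l | l.
     \<forall>\<^sub>F X :: real in at_top. \<exists>(x :: int) (y :: nat \<Rightarrow> int).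
        1 \<le> \<bar>x\<bar> \<and> real_of_int \<bar>x\<bar> \<le> X \<and>
        (MAX i\<in>{1..n}. \<bar>\<zeta> ^ i * real_of_int x - real_of_int (y i)\<bar>) \<le> X powr (- l)}"

definition w_upper :: "real \<Rightarrow> ereal" where
  "w_upper \<zeta> = limsup (\<lambda>n. w_exp n \<zeta> / ereal (real n))"

definition w_lower :: "real \<Rightarrow> ereal" where
  "w_lower \<zeta> = liminf (\<lambda>n. w_exp n \<zeta> / ereal (real n))"

definition w_hat_upper :: "real \<Rightarrow> ereal" where
  "w_hat_upper \<zeta> = limsup (\<lambda>n. w_hat_exp n \<zeta> / ereal (real n))"

definition w_hat_lower :: "real \<Rightarrow> ereal" where
  "w_hat_lower \<zeta> = liminf (\<lambda>n. w_hat_exp n \<zeta> / ereal (real n))"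

definition lambda_hat_upper :: "real \<Rightarrow> ereal" where
  "lambda_hat_upper \<zeta> = limsup (\<lambda>n. ereal (real n) * lambda_hat_exp n \<zeta>)"

definition lambda_hat_lower :: "real \<Rightarrow> ereal" where
  "lambda_hat_lower \<zeta> = liminf (\<lambda>n. ereal (real n) * lambda_hat_exp n \<zeta>)"

end

theory Submission
  imports Defs "Berlekamp_Zassenhaus.Factor_Bound" "HOL-Real_Asymp.Real_Asymp"
begin

text \<open>
  Both transfer inequalities read an integer vector \<open>z\<close> close to a multiple of
  \<open>(1, \<zeta>, \<dots>, \<zeta>^N)\<close> as a linear functional \<open>T^i \<mapsto> z\<^sub>i\<close> on polynomials of degree at most \<open>N\<close>.

  Lower bound for \<open>\<lambda>^\<^sub>N\<close>: a polynomial \<open>Q\<close> of degree at most \<open>n \<le> N\<close> which is small at \<open>\<zeta>\<close>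
  gives \<open>N - n + 1\<close> multiples \<open>T^j Q\<close>. The vectors annihilating all of them form a lattice of rank
  \<open>n\<close>, in which a pigeonhole argument produces an unusually good approximation. With \<open>u < w^\<^sub>n\<close>
  this yields \<open>\<lambda>^\<^sub>N \<ge> (n + u - N) / (u (n - 1) + N)\<close>; for \<open>u = wn\<close> and \<open>N = tn\<close> the
  product \<open>N \<lambda>^\<^sub>N\<close> is asymptotically at least \<open>t (1 + w - t) / w\<close>, maximal at \<open>t = (1 + w) / 2\<close>.

  Upper bound for \<open>\<lambda>^\<^sub>N\<close>: take \<open>P\<close> irreducible of degree at most \<open>m\<close> and small at \<open>\<zeta>\<close>, and
  \<open>Q\<close> of degree at most \<open>n\<close>, small at \<open>\<zeta>\<close> and of height slightly below that of \<open>P\<close>. They are coprime,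
  so for \<open>m + n \<le> N + 1\<close> their multiples span all polynomials of degree at most \<open>N\<close>; a too good
  approximation would annihilate them all. Hence \<open>\<lambda>^\<^sub>N \<le> 1 / min (w\<^sub>m, w^\<^sub>n)\<close>.

  The bounds on the uniform exponents \<open>w^\<^sub>n\<close> come from comparing the two inequalities.
\<close>

hide_const (open) module.smult up_ring.coeff up_ring.monom Mahler_Measure.height comm_monoid_mult_class.coprime

section \<open>Heights and linear forms\<close>

lemma eval_at_sum: "eval_at P \<zeta> = (\<Sum>i\<le>degree P. real_of_int (coeff P i) * \<zeta> ^ i)"
  by (simp add: eval_at_def poly_altdef coeff_map_poly degree_map_poly)

lemma eval_at_mult: "eval_at (P * Q) \<zeta> = eval_at P \<zeta> * eval_at Q \<zeta>"
  by (simp add: eval_at_def of_int_poly_hom.hom_mult)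

lemma eval_at_0 [simp]: "eval_at 0 \<zeta> = 0"
  by (simp add: eval_at_def)

lemma eval_at_nonzero:
  assumes "\<not> algebraic \<zeta>" "P \<noteq> 0"
  shows "eval_at P \<zeta> \<noteq> 0"
proof
  assume "eval_at P \<zeta> = 0"
  moreover have "map_poly real_of_int P \<noteq> 0" using assms(2) by simp
  moreover have "\<forall>i. coeff (map_poly real_of_int P) i \<in> \<int>" by (simp add: coeff_map_poly)
  ultimately have "algebraic \<zeta>" unfolding algebraic_def eval_at_def by blast
  with assms(1) show False by simp
qed

lemma abs_coeff_le_height: "\<bar>coeff P i\<bar> \<le> height P"
proof (cases "i \<le> degree P")
  case True
  then show ?thesis unfolding height_def by (intro Max_ge) auto
next
  case False
  then have "\<bar>coeff P i\<bar> = 0" by (simp add: coeff_eq_0)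
  also have "0 \<le> \<bar>coeff P 0\<bar>" by simp
  also have "\<dots> \<le> height P" unfolding height_def by (intro Max_ge) auto
  finally show ?thesis .
qed

lemma height_le_iff: "height P \<le> h \<longleftrightarrow> (\<forall>i. \<bar>coeff P i\<bar> \<le> h)"
proof
  assume "height P \<le> h"
  then show "\<forall>i. \<bar>coeff P i\<bar> \<le> h" using abs_coeff_le_height order_trans by blast
next
  assume "\<forall>i. \<bar>coeff P i\<bar> \<le> h"
  then show "height P \<le> h" unfolding height_def by (subst Max_le_iff) auto
qed

lemma height_nonneg: "0 \<le> height P"
  using abs_coeff_le_height[of P 0] by linarith

lemma height_ge_1: "P \<noteq> 0 \<Longrightarrow> 1 \<le> height P"
  using abs_coeff_le_height[of P "degree P"] leading_coeff_neq_0[of P] by linarith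

lemma finite_bounded_height: "finite {P. degree P \<le> n \<and> height P \<le> h}"
proof -
  have "{P. degree P \<le> n \<and> height P \<le> h} \<subseteq> Poly ` {xs. set xs \<subseteq> {-h..h} \<and> length xs \<le> Suc n}"
  proof
    fix P assume "P \<in> {P. degree P \<le> n \<and> height P \<le> h}"
    then have *: "degree P \<le> n" "height P \<le> h" by auto
    have "set (coeffs P) \<subseteq> {-h..h}"
    proof
      fix c assume "c \<in> set (coeffs P)"
      then obtain i where "c = coeff P i" by (auto simp: coeffs_def split: if_splits)
      then show "c \<in> {-h..h}" using *(2) abs_coeff_le_height[of P i] by auto
    qed
    moreover have "length (coeffs P) \<le> Suc n" using * by (auto simp: length_coeffs_degree coeffs_def)
    ultimately show "P \<in> Poly ` {xs. set xs \<subseteq> {-h..h} \<and> length xs \<le> Suc n}"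
      by (intro image_eqI[of _ _ "coeffs P"]) auto
  qed
  then show ?thesis by (rule finite_subset) (auto intro: finite_lists_length_le)
qed

text \<open>The value at \<open>T^j P\<close> of the linear functional
  \<open>T^i \<mapsto> y i\<close>. Its vanishing for consecutive \<open>j\<close> says that
  \<open>y\<close> satisfies the linear recurrence with characteristic polynomial
  \<open>P\<close>.\<close>

definition poly_form :: "int poly \<Rightarrow> (nat \<Rightarrow> int) \<Rightarrow> nat \<Rightarrow> int" where
  "poly_form P y j = (\<Sum>i\<le>degree P. coeff P i * y (i + j))"

lemma poly_form_diff: "poly_form P (\<lambda>i. y i - z i) j = poly_form P y j - poly_form P z j"
  by (simp add: poly_form_def sum_subtractf right_diff_distrib)

text \<open>Write \<open>y i\<close> as \<zeta>^i x plus an error \<open>r i\<close>. The main parts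
  add up to x \<zeta>^j P(\<zeta>), the errors to at most degree P + 1 terms of size H(P) e. The
  number \<open>Z\<close> dominates both 1 and |\<zeta>|, so Z^N bounds every power of \<zeta> that
  occurs.\<close>

lemma poly_form_bound:
  fixes \<zeta> x e Z :: real
  assumes deg: "degree P + j \<le> N" and Z: "1 \<le> Z" "\<bar>\<zeta>\<bar> \<le> Z"
    and err: "\<And>i. i \<le> N \<Longrightarrow> \<bar>real_of_int (y i) - \<zeta> ^ i * x\<bar> \<le> e"
  shows "\<bar>real_of_int (poly_form P y j)\<bar>
           \<le> \<bar>x\<bar> * Z ^ N * \<bar>eval_at P \<zeta>\<bar> + (real N + 1) * height P * e"
proof -
  define r where "r i = real_of_int (y i) - \<zeta> ^ i * x" for i
  have e0: "0 \<le> e" using err[of 0] by simp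
  have y: "real_of_int (y i) = \<zeta> ^ i * x + r i" for i by (simp add: r_def)
  have "real_of_int (poly_form P y j) = (\<Sum>i\<le>degree P. real_of_int (coeff P i) * (\<zeta> ^ (i + j) * x + r (i + j)))"
    by (simp add: poly_form_def y)
  also have "\<dots> = x * \<zeta> ^ j * eval_at P \<zeta> + (\<Sum>i\<le>degree P. real_of_int (coeff P i) * r (i + j))"
    by (simp add: eval_at_sum sum_distrib_left sum.distrib[symmetric] power_add algebra_simps)
  finally have eq: "real_of_int (poly_form P y j) = \<dots>" .
  have "\<bar>\<Sum>i\<le>degree P. real_of_int (coeff P i) * r (i + j)\<bar> \<le> (\<Sum>i\<le>degree P. height P * e)"
  proof (rule order_trans[OF sum_abs], rule sum_mono)
    fix i assume "i \<in> {..degree P}"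
    then have "\<bar>r (i + j)\<bar> \<le> e" unfolding r_def using deg by (intro err) auto
    moreover have "\<bar>real_of_int (coeff P i)\<bar> \<le> height P"
      using abs_coeff_le_height[of P i] by linarith
    ultimately show "\<bar>real_of_int (coeff P i) * r (i + j)\<bar> \<le> height P * e"
      unfolding abs_mult by (intro mult_mono) auto
  qed
  also have "\<dots> = (real (degree P) + 1) * height P * e" by simp
  also have "\<dots> \<le> (real N + 1) * height P * e"
    using deg e0 height_nonneg[of P] by (intro mult_right_mono) auto
  finally have 1: "\<bar>\<Sum>i\<le>degree P. real_of_int (coeff P i) * r (i + j)\<bar> \<le> (real N + 1) * height P * e" .
  have "\<bar>\<zeta> ^ j\<bar> \<le> Z ^ j" unfolding power_abs using Z by (intro power_mono) auto
  also have "\<dots> \<le> Z ^ N" using Z deg by (intro power_increasing) auto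
  finally have "\<bar>x * \<zeta> ^ j * eval_at P \<zeta>\<bar> \<le> \<bar>x\<bar> * Z ^ N * \<bar>eval_at P \<zeta>\<bar>"
    unfolding abs_mult by (intro mult_right_mono mult_left_mono) auto
  with 1 eq show ?thesis by linarith
qed

text \<open>The equation with index \<open>j\<close> expresses the leading coefficient times
  \<open>y (degree P + j)\<close> through earlier values. As that coefficient is a unit modulo
  \<open>M\<close>, divisibility propagates through the window by strong induction on the
  index.\<close>

lemma dvd_of_recurrence:
  fixes M :: int
  assumes cop: "coprime (lead_coeff P) M"
    and rec: "\<And>j. j \<le> l \<Longrightarrow> poly_form P y j = 0"
    and free: "\<And>i. i \<le> N \<Longrightarrow> i \<notin> {degree P..degree P + l} \<Longrightarrow> M dvd y i"
    and "i \<le> N"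
  shows "M dvd y i"
  using \<open>i \<le> N\<close>
proof (induction i rule: less_induct)
  case (less i)
  show ?case
  proof (cases "i \<in> {degree P..degree P + l}")
    case True
    define j where "j = i - degree P"
    have j: "j \<le> l" "i = degree P + j" using True by (auto simp: j_def)
    have "0 = poly_form P y j" using rec[OF j(1)] by simp
    also have "\<dots> = (\<Sum>k<degree P. coeff P k * y (k + j)) + lead_coeff P * y i"
      by (simp add: poly_form_def j lessThan_Suc_atMost[symmetric])
    finally have "lead_coeff P * y i = - (\<Sum>k<degree P. coeff P k * y (k + j))" by simp
    moreover have "M dvd (\<Sum>k<degree P. coeff P k * y (k + j))"
      using less j by (intro dvd_sum dvd_mult) auto
    ultimately have "M dvd lead_coeff P * y i" by simp
    then show ?thesis using cop coprime_dvd_mult_right_iff[of M "lead_coeff P" "y i"]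
      by (simp add: Rings.algebraic_semidom_class.coprime_commute)
  next
    case False
    then show ?thesis using free less by auto
  qed
qed

text \<open>
  As the leading coefficient of \<open>Q\<close> is invertible modulo \<open>M\<close>, a solution of the recurrence is
  determined modulo \<open>M\<close> by the \<open>n\<close> coordinates outside \<open>{degree Q..degree Q + (N - n)}\<close>; this
  replaces the rank of the annihilator lattice.
\<close>

lemma pigeonhole_mod:
  fixes M V :: nat
  assumes deg: "degree Q \<le> n" "n \<le> N" and M: "0 < M" "coprime (lead_coeff Q) (int M)"
    and A: "finite A" "\<And>z j. z \<in> A \<Longrightarrow> j \<le> N - n \<Longrightarrow> \<bar>poly_form Q z j\<bar> \<le> int V"
    and card: "(2 * V + 1) ^ (N - n + 1) * M ^ n < card A"
  obtains z z' where "z \<in> A" "z' \<in> A" "z \<noteq> z'" "\<And>i. i \<le> N \<Longrightarrow> int M dvd z i - z' i"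
proof -
  \<comment> \<open>The window takes N - n + 1 of the N + 1 indices, which leaves exactly
    \<open>n\<close> free coordinates.\<close>
  define F where "F = {..N} - {degree Q..degree Q + (N - n)}"
  have cF: "card F = n"
  proof -
    have "card F = card {..N} - card {degree Q..degree Q + (N - n)}"
      unfolding F_def using deg by (intro card_Diff_subset) auto
    then show ?thesis using deg by simp
  qed
  \<comment> \<open>A point is recorded by the exact values of its forms and the residues of its
    free coordinates. A collision makes the forms of the difference vanish and its free coordinates
    divisible by \<open>M\<close>, as \<open>dvd_of_recurrence\<close> requires.\<close>
  define \<phi> where "\<phi> z = (restrict (poly_form Q z) {..N - n}, restrict (\<lambda>i. z i mod int M) F)" for z
  let ?B = "({..N - n} \<rightarrow>\<^sub>E {- int V..int V}) \<times> (F \<rightarrow>\<^sub>E {0..<int M})"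
  have "\<phi> ` A \<subseteq> ?B"
  proof
    fix x assume "x \<in> \<phi> ` A"
    then obtain z where z: "z \<in> A" "x = \<phi> z" by blast
    have "restrict (poly_form Q z) {..N - n} \<in> {..N - n} \<rightarrow>\<^sub>E {- int V..int V}"
    proof (rule restrict_PiE_iff[THEN iffD2], rule ballI)
      fix j assume "j \<in> {..N - n}"
      then show "poly_form Q z j \<in> {- int V..int V}" using A(2)[OF z(1), of j] by auto
    qed
    moreover have "restrict (\<lambda>i. z i mod int M) F \<in> F \<rightarrow>\<^sub>E {0..<int M}"
      using M(1) by (intro restrict_PiE_iff[THEN iffD2]) auto
    ultimately show "x \<in> ?B" by (simp add: z(2) \<phi>_def)
  qed
  moreover have "finite ?B" by (intro finite_cartesian_product finite_PiE) (auto simp: F_def)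
  moreover have "card ?B = (2 * V + 1) ^ (N - n + 1) * M ^ n"
  proof -
    have "finite F" by (simp add: F_def)
    moreover have "nat (2 * int V + 1) = 2 * V + 1" by simp
    ultimately show ?thesis by (simp add: card_cartesian_product card_PiE cF)
  qed
  ultimately have "card (\<phi> ` A) \<le> (2 * V + 1) ^ (N - n + 1) * M ^ n"
    using card_mono[of ?B "\<phi> ` A"] by (simp only:)
  then have "card (\<phi> ` A) < card A" using card by (rule le_less_trans)
  then have "\<not> inj_on \<phi> A" by (rule pigeonhole)
  then obtain z z' where z: "z \<in> A" "z' \<in> A" "z \<noteq> z'" "\<phi> z = \<phi> z'" by (auto simp: inj_on_def)
  have 1: "poly_form Q z j = poly_form Q z' j" if "j \<le> N - n" for j
    using fun_cong[OF arg_cong[OF z(4), of fst], of j] that by (simp add: \<phi>_def)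
  have 2: "z i mod int M = z' i mod int M" if "i \<in> F" for i
    using fun_cong[OF arg_cong[OF z(4), of snd], of i] that by (simp add: \<phi>_def)
  have "int M dvd z i - z' i" if "i \<le> N" for i
  proof (rule dvd_of_recurrence[of Q _ "N - n" "\<lambda>i. z i - z' i" N])
    show "poly_form Q (\<lambda>i. z i - z' i) j = 0" if "j \<le> N - n" for j
      using 1[OF that] by (simp add: poly_form_diff)
    show "int M dvd z i - z' i" if "i \<le> N" "i \<notin> {degree Q..degree Q + (N - n)}" for i
      using 2[of i] that by (auto simp: F_def mod_eq_dvd_iff)
  qed (use M that in auto)
  with z show ?thesis using that by blast
qed

section \<open>Integer points from one small polynomial\<close>

text \<open>There are S K^N integer points with 0 \<le> z_0 < S whose other coordinates lie within K
  of \<zeta>^i z_0. Their forms are bounded by \<open>V\<close>, so two of them agree modulo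
  \<open>M\<close>; the quotient of their difference by \<open>M\<close> is the required
  point.\<close>

lemma lattice_point_finite:
  fixes M S K V :: nat and \<zeta> Z X \<delta> :: real
  assumes deg: "degree Q \<le> n" "n \<le> N" and M: "0 < M" "coprime (lead_coeff Q) (int M)"
    and Z: "1 \<le> Z" "\<bar>\<zeta>\<bar> \<le> Z" and Q: "height Q \<le> X" "\<bar>eval_at Q \<zeta>\<bar> \<le> \<delta>"
    and V: "S * Z ^ N * \<delta> + (real N + 1) * X * K \<le> V"
    and card: "(2 * V + 1) ^ (N - n + 1) * M ^ n < S * K ^ N"
  obtains z :: "nat \<Rightarrow> int" where "\<exists>i\<le>N. z i \<noteq> 0" "M * \<bar>real_of_int (z 0)\<bar> \<le> S"
    "\<And>i. i \<le> N \<Longrightarrow> M * \<bar>real_of_int (z i) - \<zeta> ^ i * z 0\<bar> \<le> K"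
proof -
  define D where "D = {..<S} \<times> ({1..N} \<rightarrow>\<^sub>E {..<K})"
  \<comment> \<open>Rounding up puts the errors into the interval from 0 to K, so the difference of
    two points has error at most K instead of 2K. Coordinates beyond \<open>N\<close> are 0, hence
    distinct points differ at some index up to \<open>N\<close>.\<close>
  define p where "p = (\<lambda>(s :: nat, k :: nat \<Rightarrow> nat) i.
     if i = 0 then int s else if i \<le> N then \<lceil>\<zeta> ^ i * s\<rceil> + int (k i) else 0)"
  have fin: "finite D" unfolding D_def by (intro finite_cartesian_product finite_PiE) auto
  have cD: "card D = S * K ^ N" unfolding D_def by (simp add: card_cartesian_product card_PiE)
  have "inj_on p D"
  proof (rule inj_onI, clarify)
    fix s k s' k' assume sk: "(s, k) \<in> D" "(s', k') \<in> D" and eq: "p (s, k) = p (s', k')"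
    have s: "s = s'" using fun_cong[OF eq, of 0] by (simp add: p_def)
    moreover have "k = k'"
    proof
      fix i show "k i = k' i"
      proof (cases "i \<in> {1..N}")
        case True
        then show ?thesis using fun_cong[OF eq, of i] s by (simp add: p_def)
      next
        case False
        then show ?thesis using sk unfolding D_def by (auto simp: PiE_def extensional_def)
      qed
    qed
    ultimately show "s = s' \<and> k = k'" by simp
  qed
  then have card': "card (p ` D) = S * K ^ N" by (simp add: card_image cD)
  have err: "0 \<le> real_of_int (p d i) - \<zeta> ^ i * p d 0 \<and> real_of_int (p d i) - \<zeta> ^ i * p d 0 \<le> K"
    if "d \<in> D" "i \<le> N" for d i
  proof -
    obtain s k where d: "d = (s, k)" by (cases d)
    show ?thesis
    proof (cases "i = 0")
      case False
      then have "k i < K" using that d by (auto simp: D_def)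
      then have "real (k i) + 1 \<le> K" by simp
      moreover have "0 \<le> real_of_int \<lceil>\<zeta> ^ i * s\<rceil> - \<zeta> ^ i * s" "real_of_int \<lceil>\<zeta> ^ i * s\<rceil> - \<zeta> ^ i * s \<le> 1"
        by linarith+
      moreover have "real_of_int (p d i) - \<zeta> ^ i * p d 0 = (real_of_int \<lceil>\<zeta> ^ i * s\<rceil> - \<zeta> ^ i * s) + k i"
        using False that by (simp add: d p_def)
      ultimately show ?thesis by linarith
    qed (simp add: p_def d)
  qed
  have p0: "0 \<le> p d 0 \<and> p d 0 < S" if "d \<in> D" for d
    using that by (cases d) (auto simp: p_def D_def)
  have bound: "\<bar>poly_form Q z j\<bar> \<le> int V" if zj: "z \<in> p ` D" "j \<le> N - n" for z j
  proof -
    obtain d where d: "d \<in> D" "z = p d" using zj(1) by blast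
    have "\<bar>real_of_int (poly_form Q z j)\<bar>
       \<le> \<bar>real_of_int (z 0)\<bar> * Z ^ N * \<bar>eval_at Q \<zeta>\<bar> + (real N + 1) * height Q * K"
      using err[OF d(1)] d deg zj Z by (intro poly_form_bound) (auto simp: abs_le_iff)
    also have "\<dots> \<le> S * Z ^ N * \<delta> + (real N + 1) * X * K"
      using p0[OF d(1)] d Q Z height_nonneg[of Q] by (intro add_mono mult_mono mult_nonneg_nonneg) auto
    also have "\<dots> \<le> V" by (rule V)
    finally show ?thesis by linarith
  qed
  obtain z z' where z: "z \<in> p ` D" "z' \<in> p ` D" "z \<noteq> z'" "\<And>i. i \<le> N \<Longrightarrow> int M dvd z i - z' i"
    using pigeonhole_mod[OF deg M, of "p ` D" V] fin bound card card' by auto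
  obtain d d' where d: "d \<in> D" "z = p d" "d' \<in> D" "z' = p d'" using z(1,2) by blast
  define t where "t i = (z i - z' i) div int M" for i
  have t: "z i - z' i = int M * t i" if "i \<le> N" for i using z(4)[OF that] by (simp add: t_def)
  have rt: "real M * real_of_int (t i) = real_of_int (z i) - real_of_int (z' i)" if "i \<le> N" for i
    using arg_cong[OF t[OF that], of real_of_int] by simp
  show ?thesis
  proof (rule that[of t])
    obtain i where i: "z i \<noteq> z' i" using z(3) by auto
    then have "i \<le> N" using d by (cases "i \<le> N") (auto simp: p_def split: prod.splits)
    then show "\<exists>i\<le>N. t i \<noteq> 0" using t i by fastforce
    have "M * \<bar>real_of_int (t 0)\<bar> = \<bar>real_of_int (z 0) - real_of_int (z' 0)\<bar>"
      using rt[of 0] by (metis abs_mult abs_of_nat le0)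
    also have "\<dots> = real_of_int \<bar>z 0 - z' 0\<bar>" by simp
    also have "\<dots> \<le> real_of_int (int S)"
      using p0[OF d(1)] p0[OF d(3)] by (intro of_int_le_iff[THEN iffD2]) (auto simp: d abs_le_iff)
    also have "\<dots> = S" by simp
    finally show "M * \<bar>real_of_int (t 0)\<bar> \<le> S" .
    fix i assume i: "i \<le> N"
    have "M * \<bar>real_of_int (t i) - \<zeta> ^ i * t 0\<bar> = \<bar>real M * (real_of_int (t i) - \<zeta> ^ i * t 0)\<bar>"
      by (simp add: abs_mult)
    also have "\<dots> = \<bar>real M * real_of_int (t i) - \<zeta> ^ i * (real M * t 0)\<bar>"
      by (simp add: algebra_simps)
    also have "\<dots> = \<bar>(real_of_int (z i) - \<zeta> ^ i * z 0) - (real_of_int (z' i) - \<zeta> ^ i * z' 0)\<bar>"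
      unfolding rt[OF i] rt[OF le0] by (simp add: algebra_simps)
    also have "\<dots> \<le> K" unfolding d abs_le_iff
      using conjunct1[OF err[OF d(1) i]] conjunct2[OF err[OF d(1) i]]
        conjunct1[OF err[OF d(3) i]] conjunct2[OF err[OF d(3) i]] by linarith
    finally show "M * \<bar>real_of_int (t i) - \<zeta> ^ i * t 0\<bar> \<le> K" .
  qed
qed

text \<open>
  The points above have the size of \<open>M\<close> times the box of interest; dividing a difference that
  is divisible by \<open>M\<close> and letting \<open>M \<rightarrow> \<infinity>\<close> removes all rounding errors.
\<close>

lemma lattice_point:
  fixes \<zeta> Z X \<delta> a b :: real
  assumes Q0: "Q \<noteq> 0" and deg: "degree Q \<le> n" "n \<le> N"
    and Z: "1 \<le> Z" "\<bar>\<zeta>\<bar> \<le> Z" and Q: "height Q \<le> X" "\<bar>eval_at Q \<zeta>\<bar> \<le> \<delta>"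
    and ab: "0 < a" "0 < b"
    and vol: "(2 * a * Z ^ N * \<delta> + 2 * (real N + 1) * X * b) ^ (N - n + 1) < a * b ^ N"
  obtains z :: "nat \<Rightarrow> int" where "\<exists>i\<le>N. z i \<noteq> 0" "\<bar>real_of_int (z 0)\<bar> \<le> a"
    "\<And>i. i \<le> N \<Longrightarrow> \<bar>real_of_int (z i) - \<zeta> ^ i * z 0\<bar> \<le> b"
proof -
  define r where "r = N - n + 1"
  define c where "c = 2 * a * Z ^ N * \<delta> + 2 * (real N + 1) * X * b"
  have \<delta>0: "0 \<le> \<delta>" using Q by linarith
  have X0: "0 \<le> X" using Q height_nonneg[of Q] by linarith
  \<comment> \<open>The moduli will be M = k q + 1: coprime to the leading coefficient for every
    \<open>k\<close>, and unbounded. \<open>\<epsilon> k\<close> is 1 / M, the size of a rounding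
    error after division by \<open>M\<close>.\<close>
  define q where "q = nat \<bar>lead_coeff Q\<bar>"
  have q: "q > 0" using Q0 by (simp add: q_def)
  define \<epsilon> where "\<epsilon> k = 1 / (real k * real q + 1)" for k
  have "filterlim (\<lambda>k. real k * real q + 1) at_top sequentially"
    using q by real_asymp
  then have \<epsilon>: "\<epsilon> \<longlonglongrightarrow> 0" unfolding \<epsilon>_def
    by (intro tendsto_divide_0[OF tendsto_const] filterlim_at_top_imp_at_infinity)
  \<comment> \<open>The strict volume inequality survives small perturbations, so it still holds
    with rounding errors once \<open>k\<close> is large.\<close>
  have "(\<lambda>k. (a - \<epsilon> k) * (b - \<epsilon> k) ^ N - (c + 3 * \<epsilon> k) ^ r) \<longlonglongrightarrow> (a - 0) * (b - 0) ^ N - (c + 3 * 0) ^ r"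
    by (intro tendsto_intros \<epsilon>)
  moreover have "(a - 0) * (b - 0) ^ N - (c + 3 * 0) ^ r > 0" using vol by (simp add: c_def r_def)
  ultimately have "\<forall>\<^sub>F k in sequentially. (a - \<epsilon> k) * (b - \<epsilon> k) ^ N - (c + 3 * \<epsilon> k) ^ r > 0"
    by (rule order_tendstoD)
  moreover have "\<forall>\<^sub>F k in sequentially. \<epsilon> k < a" using order_tendstoD(2)[OF \<epsilon> ab(1)] .
  moreover have "\<forall>\<^sub>F k in sequentially. \<epsilon> k < b" using order_tendstoD(2)[OF \<epsilon> ab(2)] .
  ultimately have "\<forall>\<^sub>F k in sequentially. (c + 3 * \<epsilon> k) ^ r < (a - \<epsilon> k) * (b - \<epsilon> k) ^ N \<and> \<epsilon> k < a \<and> \<epsilon> k < b"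
    by eventually_elim auto
  then obtain k where k: "(c + 3 * \<epsilon> k) ^ r < (a - \<epsilon> k) * (b - \<epsilon> k) ^ N" "\<epsilon> k < a" "\<epsilon> k < b"
    using eventually_happens' sequentially_bot by blast
  define M where "M = k * q + 1"
  have M0: "0 < M" by (simp add: M_def)
  have \<epsilon>M: "\<epsilon> k * M = 1" unfolding \<epsilon>_def M_def using M0 by (simp add: add_nonneg_eq_0_iff)
  have cop: "coprime (lead_coeff Q) (int M)"
  proof -
    have "int M = int k * \<bar>lead_coeff Q\<bar> + 1" by (simp add: M_def q_def)
    moreover have "coprime \<bar>lead_coeff Q\<bar> (int k * \<bar>lead_coeff Q\<bar> + 1)"
    proof (rule algebraic_semidom_class.coprimeI)
      fix d assume "d dvd \<bar>lead_coeff Q\<bar>" "d dvd int k * \<bar>lead_coeff Q\<bar> + 1"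
      then show "is_unit d" using dvd_add_right_iff[of d "int k * \<bar>lead_coeff Q\<bar>" 1] by simp
    qed
    ultimately have "coprime \<bar>lead_coeff Q\<bar> (int M)" by simp
    then show ?thesis by simp
  qed
  define S where "S = nat \<lfloor>M * a\<rfloor>"
  define K where "K = nat \<lfloor>M * b\<rfloor>"
  define V where "V = nat \<lceil>S * Z ^ N * \<delta> + (real N + 1) * X * K\<rceil>"
  have "0 \<le> M * a" "0 \<le> M * b" using ab by auto
  then have S: "real S \<le> M * a" "M * a - 1 \<le> S" and K: "real K \<le> M * b" "M * b - 1 \<le> K"
    unfolding S_def K_def by linarith+
  have V: "S * Z ^ N * \<delta> + (real N + 1) * X * K \<le> V" unfolding V_def by linarith
  have nn: "0 \<le> S * Z ^ N * \<delta> + (real N + 1) * X * K"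
    using \<delta>0 X0 Z by (intro add_nonneg_nonneg mult_nonneg_nonneg) auto
  have "real V \<le> S * Z ^ N * \<delta> + (real N + 1) * X * K + 1" unfolding V_def using nn by linarith
  also have "\<dots> \<le> (M * a) * Z ^ N * \<delta> + (real N + 1) * X * (M * b) + 1"
    using S K \<delta>0 X0 Z ab by (intro add_mono mult_mono) auto
  \<comment> \<open>The ceiling in \<open>V\<close> costs 1, which is doubled; the summand 1 in 2 V
    + 1 gives the third unit.\<close>
  finally have "2 * real V + 1 \<le> M * c + 3" by (simp add: c_def algebra_simps)
  also have "\<dots> = M * (c + 3 * \<epsilon> k)" using \<epsilon>M by (simp add: algebra_simps)
  finally have V2: "2 * real V + 1 \<le> M * (c + 3 * \<epsilon> k)" .
  have "(2 * real V + 1) ^ r * real M ^ n \<le> (M * (c + 3 * \<epsilon> k)) ^ r * real M ^ n"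
    using V2 by (intro mult_right_mono power_mono) auto
  also have "\<dots> = real M ^ (N + 1) * (c + 3 * \<epsilon> k) ^ r"
    using deg by (simp add: power_mult_distrib r_def power_add[symmetric] mult.assoc mult.left_commute)
  also have "\<dots> < real M ^ (N + 1) * ((a - \<epsilon> k) * (b - \<epsilon> k) ^ N)"
    using k(1) M0 by (intro mult_strict_left_mono) auto
  also have "\<dots> = (M * a - \<epsilon> k * M) * (M * b - \<epsilon> k * M) ^ N"
    by (simp add: power_mult_distrib[symmetric] algebra_simps)
  also have "\<dots> \<le> S * real K ^ N"
  proof (intro mult_mono power_mono)
    have "\<epsilon> k * M < M * b" using k(3) M0 by simp
    then show "0 \<le> M * b - \<epsilon> k * M" by simp
    then show "0 \<le> (M * b - \<epsilon> k * M) ^ N" by simp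
  qed (use S K \<epsilon>M in auto)
  finally have "real ((2 * V + 1) ^ r * M ^ n) < real (S * K ^ N)"
    by (simp add: add.commute)
  then have card: "(2 * V + 1) ^ (N - n + 1) * M ^ n < S * K ^ N" unfolding r_def of_nat_less_iff .
  obtain z :: "nat \<Rightarrow> int" where z: "\<exists>i\<le>N. z i \<noteq> 0" "M * \<bar>real_of_int (z 0)\<bar> \<le> S"
    "\<And>i. i \<le> N \<Longrightarrow> M * \<bar>real_of_int (z i) - \<zeta> ^ i * z 0\<bar> \<le> K"
    using lattice_point_finite[OF deg M0 cop Z Q V card] by blast
  show ?thesis
  proof (rule that[of z])
    have "M * \<bar>real_of_int (z 0)\<bar> \<le> M * a" using z(2) S by linarith
    then show "\<bar>real_of_int (z 0)\<bar> \<le> a" using M0 by simp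
    fix i assume "i \<le> N"
    then have "M * \<bar>real_of_int (z i) - \<zeta> ^ i * z 0\<bar> \<le> M * b" using z(3)[of i] K by linarith
    then show "\<bar>real_of_int (z i) - \<zeta> ^ i * z 0\<bar> \<le> b" using M0 by simp
  qed (use z in blast)
qed

section \<open>A lower bound for the uniform exponent of simultaneous approximation\<close>

lemma ereal_le_of_less:
  assumes "\<And>l :: real. l < r \<Longrightarrow> ereal l \<le> s"
  shows "ereal r \<le> s"
proof (rule dense_le)
  fix y assume y: "y < ereal r"
  show "y \<le> s"
  proof (cases y)
    case (real l) then show ?thesis using assms y by auto
  qed (use y in auto)
qed

text \<open>Admissible exponents are closed downwards, because X^(-w) decreases in \<open>w\<close>
  for X \<ge> 1.\<close>

lemma less_w_hat_expD:
  assumes "ereal u < w_hat_exp n \<zeta>"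
  shows "\<forall>\<^sub>F X :: real in at_top. \<exists>P. degree P \<le> n \<and> real_of_int (height P) \<le> X \<and>
           0 < \<bar>eval_at P \<zeta>\<bar> \<and> \<bar>eval_at P \<zeta>\<bar> \<le> X powr (- u)"
proof -
  obtain v where v: "u < v" "\<forall>\<^sub>F X :: real in at_top. \<exists>P. degree P \<le> n \<and> real_of_int (height P) \<le> X \<and>
        0 < \<bar>eval_at P \<zeta>\<bar> \<and> \<bar>eval_at P \<zeta>\<bar> \<le> X powr (- v)"
    using assms unfolding w_hat_exp_def less_Sup_iff by auto
  from v(2) eventually_ge_at_top[of 1] show ?thesis
  proof eventually_elim
    case (elim X)
    then have "X powr (- v) \<le> X powr (- u)" using v(1) by (intro powr_mono) auto
    then show ?case using elim(1) order_trans by blast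
  qed
qed

lemma w_hat_exp_geI:
  assumes "\<forall>\<^sub>F X :: real in at_top. \<exists>P. degree P \<le> n \<and> real_of_int (height P) \<le> X \<and>
           0 < \<bar>eval_at P \<zeta>\<bar> \<and> \<bar>eval_at P \<zeta>\<bar> \<le> X powr (- u)"
  shows "ereal u \<le> w_hat_exp n \<zeta>"
  unfolding w_hat_exp_def using assms by (intro Sup_upper CollectI exI[of _ u] conjI refl)

text \<open>Indexing the vector from 0 with \<open>z 0\<close> as the denominator adds only a
  trivial condition at i = 0, and N \<ge> 1 makes the maximum one over a nonempty set.\<close>

lemma lambda_hat_exp_geI:
  fixes \<zeta> l :: real
  assumes "1 \<le> N"
    and "\<forall>\<^sub>F Y :: real in at_top. \<exists>z :: nat \<Rightarrow> int. z 0 \<noteq> 0 \<and> \<bar>real_of_int (z 0)\<bar> \<le> Y \<and>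
           (\<forall>i\<le>N. \<bar>real_of_int (z i) - \<zeta> ^ i * z 0\<bar> \<le> Y powr (- l))"
  shows "ereal l \<le> lambda_hat_exp N \<zeta>"
proof -
  from assms(2) have "\<forall>\<^sub>F X :: real in at_top. \<exists>(x :: int) (y :: nat \<Rightarrow> int).
        1 \<le> \<bar>x\<bar> \<and> real_of_int \<bar>x\<bar> \<le> X \<and>
        (MAX i\<in>{1..N}. \<bar>\<zeta> ^ i * real_of_int x - real_of_int (y i)\<bar>) \<le> X powr (- l)"
  proof eventually_elim
    case (elim Y)
    then obtain z :: "nat \<Rightarrow> int" where z: "z 0 \<noteq> 0" "\<bar>real_of_int (z 0)\<bar> \<le> Y"
       "\<And>i. i \<le> N \<Longrightarrow> \<bar>real_of_int (z i) - \<zeta> ^ i * z 0\<bar> \<le> Y powr (- l)" by blast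
    have "(MAX i\<in>{1..N}. \<bar>\<zeta> ^ i * real_of_int (z 0) - real_of_int (z i)\<bar>) \<le> Y powr (- l)"
      using assms(1) z(3) by (subst Max_le_iff) (auto simp: abs_minus_commute)
    then show ?case using z by (intro exI[of _ "z 0"] exI[of _ z]) auto
  qed
  then show ?thesis unfolding lambda_hat_exp_def by (intro Sup_upper CollectI exI[of _ l] conjI refl)
qed

text \<open>Take \<open>Q\<close> of height at most X with |Q(\<zeta>)| \<le> X^(-u), and a box with
  sides a = C X^\<alpha> and b = C X^(-\<beta>). The two contributions a X^(-u) and X b to the forms
  balance when \<alpha> = 1 + u - \<beta>. The volume condition of \<open>lattice_point\<close> then
  reads X^(N - n - u) < b^n up to constants, whence \<beta> = (n + u - N) / n. The exponent obtained
  is \<beta> / \<alpha>.\<close>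

lemma lambda_hat_exp_ge:
  fixes u :: real
  assumes n: "1 \<le> n" "n \<le> N" and u: "0 < u" "ereal u < w_hat_exp n \<zeta>" and N: "real N < n + u"
  shows "ereal ((n + u - N) / (u * (real n - 1) + N)) \<le> lambda_hat_exp N \<zeta>"
proof (rule ereal_le_of_less)
  fix l assume l: "l < (n + u - N) / (u * (real n - 1) + N)"
  define \<beta> where "\<beta> = (n + u - N) / n"
  define \<alpha> where "\<alpha> = (u * (real n - 1) + N) / n"
  have \<alpha>: "0 < \<alpha>" unfolding \<alpha>_def using n u by (intro divide_pos_pos add_nonneg_pos mult_nonneg_nonneg) auto
  have \<beta>: "0 < \<beta>" unfolding \<beta>_def using n N by auto
  have \<alpha>\<beta>: "\<alpha> = 1 + u - \<beta>" unfolding \<alpha>_def \<beta>_def using n by (simp add: field_simps)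
  define g where "g = \<beta> / \<alpha>"
  have g: "l < g" using l n by (simp add: g_def \<alpha>_def \<beta>_def)
  have g0: "0 < g" using \<alpha> \<beta> by (simp add: g_def)
  define Z where "Z = max 1 \<bar>\<zeta>\<bar>"
  have Z: "1 \<le> Z" "\<bar>\<zeta>\<bar> \<le> Z" by (auto simp: Z_def)
  define r where "r = N - n + 1"
  define D where "D = 2 * Z ^ N + 2 * (real N + 1)"
  have D: "0 < D" unfolding D_def using Z by (intro add_pos_pos) auto
  \<comment> \<open>Any constant above 1 with D^r < C^n serves; it absorbs the factors of the volume
    condition and does not affect the exponent.\<close>
  define C where "C = D ^ r + 1"
  have C: "1 < C" using D by (simp add: C_def)
  have "D ^ r < C" by (simp add: C_def)
  also have "\<dots> \<le> C ^ n" using C n by (intro self_le_power) auto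
  finally have DC: "D ^ r < C ^ n" .
  \<comment> \<open>This choice makes the bound \<open>a\<close> = C X^\<alpha> for the denominator
    equal to \<open>Y\<close>.\<close>
  define X where "X = (\<lambda>Y. (Y / C) powr (1 / \<alpha>))"
  have "filterlim X at_top at_top" unfolding X_def using C \<alpha> by real_asymp
  with less_w_hat_expD[OF u(2)] have "\<forall>\<^sub>F Y in at_top. \<exists>P. degree P \<le> n \<and> real_of_int (height P) \<le> X Y \<and>
           0 < \<bar>eval_at P \<zeta>\<bar> \<and> \<bar>eval_at P \<zeta>\<bar> \<le> X Y powr (- u)"
    by (rule eventually_compose_filterlim)
  moreover have "\<forall>\<^sub>F Y in at_top. C * (Y / C) powr (- g) \<le> Y powr (- l)"
    using C g by real_asymp
  moreover have "\<forall>\<^sub>F Y in at_top. C * (Y / C) powr (- g) < 1"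
    using C g0 by real_asymp
  moreover have "\<forall>\<^sub>F Y :: real in at_top. 0 < Y" by (rule eventually_gt_at_top)
  ultimately have "\<forall>\<^sub>F Y :: real in at_top. \<exists>z :: nat \<Rightarrow> int. z 0 \<noteq> 0 \<and> \<bar>real_of_int (z 0)\<bar> \<le> Y \<and>
           (\<forall>i\<le>N. \<bar>real_of_int (z i) - \<zeta> ^ i * z 0\<bar> \<le> Y powr (- l))"
  proof eventually_elim
    case (elim Y)
    then obtain Q where Q: "degree Q \<le> n" "real_of_int (height Q) \<le> X Y"
       "0 < \<bar>eval_at Q \<zeta>\<bar>" "\<bar>eval_at Q \<zeta>\<bar> \<le> X Y powr (- u)" by blast
    have Q0: "Q \<noteq> 0" using Q(3) by auto
    define b where "b = C * X Y powr (- \<beta>)"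
    define a where "a = X Y powr (1 + u) * b"
    have X0: "0 < X Y" unfolding X_def using elim C by auto
    have b: "0 < b" unfolding b_def using X0 C by auto
    have a: "0 < a" unfolding a_def using X0 b by auto
    have b': "b = C * (Y / C) powr (- g)" by (simp add: b_def X_def powr_powr g_def)
    have "a = C * X Y powr \<alpha>" by (simp add: a_def b_def \<alpha>\<beta> powr_add[symmetric])
    also have "X Y powr \<alpha> = Y / C" unfolding X_def powr_powr using \<alpha> elim C by simp
    finally have a': "a = Y" using C by simp
    have a\<delta>: "a * X Y powr (- u) = X Y * b" using X0
      by (simp add: a_def powr_add[symmetric] mult.commute mult.left_commute)
    have "2 * a * Z ^ N * X Y powr (- u) + 2 * (real N + 1) * X Y * b = 2 * Z ^ N * (a * X Y powr (- u)) + 2 * (real N + 1) * X Y * b"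
      by simp
    also have "\<dots> = D * (X Y * b)" unfolding a\<delta> D_def by (simp add: algebra_simps)
    finally have "(2 * a * Z ^ N * X Y powr (- u) + 2 * (real N + 1) * X Y * b) ^ (N - n + 1) = D ^ r * (X Y ^ r * b ^ r)"
      unfolding r_def[symmetric] by (simp add: power_mult_distrib)
    also have "\<dots> < C ^ n * (X Y ^ r * b ^ r)" using DC X0 b by (intro mult_strict_right_mono) auto
    also have "\<dots> = a * b ^ N"
    proof -
      have "b ^ n = C ^ n * X Y powr (- (\<beta> * n))"
        using X0 by (simp add: b_def power_mult_distrib powr_powr powr_realpow[symmetric])
      also have "\<beta> * n = n + u - N" using n by (simp add: \<beta>_def)
      finally have bn: "b ^ n = C ^ n * X Y powr (real N - real n - u)" by (simp add: algebra_simps)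
      have "real r = (1 + u) + (real N - real n - u)" using n by (simp add: r_def of_nat_diff)
      then have "X Y ^ r = X Y powr (1 + u) * X Y powr (real N - real n - u)"
        using powr_realpow[OF X0, of r] powr_add[of "X Y" "1 + u" "real N - real n - u"] by simp
      then have "C ^ n * (X Y ^ r * b ^ r) = X Y powr (1 + u) * (b ^ n * b ^ r)" by (simp add: bn)
      also have "b ^ n * b ^ r = b * b ^ N" using n by (simp add: r_def flip: power_add)
      finally show ?thesis by (simp add: a_def)
    qed
    finally have vol: "(2 * a * Z ^ N * X Y powr (- u) + 2 * (real N + 1) * X Y * b) ^ (N - n + 1) < a * b ^ N" .
    obtain z :: "nat \<Rightarrow> int" where z: "\<exists>i\<le>N. z i \<noteq> 0" "\<bar>real_of_int (z 0)\<bar> \<le> a"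
      "\<And>i. i \<le> N \<Longrightarrow> \<bar>real_of_int (z i) - \<zeta> ^ i * z 0\<bar> \<le> b"
      using lattice_point[OF Q0 Q(1) n(2) Z Q(2) Q(4) a b vol] by blast
    have "z 0 \<noteq> 0"
    proof
      assume z0: "z 0 = 0"
      obtain i where i: "i \<le> N" "z i \<noteq> 0" using z(1) by blast
      have "\<bar>real_of_int (z i)\<bar> < 1" using z(3)[OF i(1)] z0 elim(3) b' by simp
      then show False using i(2) by linarith
    qed
    moreover have "\<bar>real_of_int (z i) - \<zeta> ^ i * z 0\<bar> \<le> Y powr (- l)" if "i \<le> N" for i
      using z(3)[OF that] elim(2) b' by linarith
    ultimately show ?case using z(2) a' by blast
  qed
  then show "ereal l \<le> lambda_hat_exp N \<zeta>" using n by (intro lambda_hat_exp_geI[of N]) auto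
qed

section \<open>Irreducible factors and coprime recurrences\<close>

lemma mahler_measure_mult:
  "mahler_measure (P * Q) = mahler_measure P * mahler_measure Q"
  unfolding mahler_measure_def of_int_poly_hom.hom_mult measure_eq_prod ..

text \<open>Mignotte's bound for each coefficient, with the binomial coefficient estimated by
  2^m.\<close>

lemma height_le_mahler_measure:
  assumes "degree P \<le> m"
  shows "height P \<le> 2 ^ m * mahler_measure P"
proof -
  obtain i where i: "height P = \<bar>coeff P i\<bar>"
  proof -
    have "height P \<in> (\<lambda>i. \<bar>coeff P i\<bar>) ` {..degree P}" unfolding height_def by (intro Max_in) auto
    then show ?thesis using that by blast
  qed
  have "real (degree P choose i) \<le> 2 ^ m"
  proof -
    have "(degree P choose i) \<le> 2 ^ degree P" by (rule binomial_le_pow2)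
    also have "\<dots> \<le> 2 ^ m" using assms by (intro power_increasing) auto
    finally have "real (degree P choose i) \<le> real (2 ^ m)" unfolding of_nat_le_iff .
    then show ?thesis by simp
  qed
  then have "(degree P choose i) * mahler_measure P \<le> 2 ^ m * mahler_measure P"
    using mahler_measure_ge_0 by (intro mult_right_mono)
  then show ?thesis using Mignotte_bound[of P i] unfolding i by linarith
qed

text \<open>Landau's inequality bounds the Mahler measure by the Euclidean norm of the coefficients.
  The factor m + 1 in place of its square root keeps the constant simple.\<close>

lemma mahler_measure_le_height:
  assumes "degree P \<le> m"
  shows "mahler_measure P \<le> (real m + 1) * height P"
proof -
  let ?f = "map_poly complex_of_int P"
  have h: "0 \<le> real_of_int (height P)" using height_nonneg[of P] by simp
  have "(\<Sum>a\<leftarrow>coeffs ?f. (cmod a)\<^sup>2) \<le> (\<Sum>a\<leftarrow>coeffs ?f. (real_of_int (height P))\<^sup>2)"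
  proof (rule sum_list_mono)
    fix a assume "a \<in> set (coeffs ?f)"
    then obtain i where "a = coeff ?f i" by (auto simp: coeffs_def split: if_splits)
    then have "cmod a = real_of_int \<bar>coeff P i\<bar>" by (simp add: coeff_map_poly)
    also have "\<dots> \<le> height P" using abs_coeff_le_height by (intro of_int_le_iff[THEN iffD2])
    finally show "(cmod a)\<^sup>2 \<le> (real_of_int (height P))\<^sup>2" by (intro power_mono) auto
  qed
  also have "\<dots> = length (coeffs ?f) * (real_of_int (height P))\<^sup>2" by (rule sum_list_triv)
  also have "\<dots> \<le> (real m + 1) * (real_of_int (height P))\<^sup>2"
    using assms by (intro mult_right_mono) (auto simp: coeffs_def degree_map_poly)
  also have "\<dots> \<le> (real m + 1)\<^sup>2 * (real_of_int (height P))\<^sup>2"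
    by (intro mult_right_mono self_le_power) auto
  also have "\<dots> = ((real m + 1) * height P)\<^sup>2" by (simp add: power_mult_distrib)
  finally have "sqrt (\<Sum>a\<leftarrow>coeffs ?f. (cmod a)\<^sup>2) \<le> (real m + 1) * height P"
    using h by (intro real_le_lsqrt) (auto intro!: mult_nonneg_nonneg)
  then show ?thesis using Landau_inequality[of ?f] unfolding mahler_measure_def by linarith
qed

text \<open>
  The quantity \<open>\<bar>P(\<zeta>)\<bar> M(P)^w\<close>, with \<open>M\<close> the Mahler measure, is multiplicative, so if it is
  tiny for \<open>P\<close> then it is small for some irreducible factor of \<open>P\<close>.
\<close>

lemma irreducible_approximations:
  fixes \<zeta> w :: real
  assumes tr: "\<not> algebraic \<zeta>" and w: "0 \<le> w" "ereal w < w_exp m \<zeta>"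
  shows "infinite {P. irreducible P \<and> 0 < degree P \<and> degree P \<le> m \<and>
                      \<bar>eval_at P \<zeta>\<bar> * mahler_measure P powr w \<le> 1}" (is "infinite ?S")
proof
  assume fin: "finite ?S"
  define f where "f P = \<bar>eval_at P \<zeta>\<bar> * mahler_measure P powr w" for P
  have f_mult: "f (P * Q) = f P * f Q" for P Q
    by (simp add: f_def eval_at_mult mahler_measure_mult abs_mult powr_mult mahler_measure_ge_0)
  have f_pos: "0 < f P" if "P \<noteq> 0" for P
    using eval_at_nonzero[OF tr that] mahler_measure_poly_ge_1[OF that] by (simp add: f_def)
  have f_const: "1 \<le> f P" if "P \<noteq> 0" "degree P = 0" for P
  proof -
    obtain c where c: "P = [:c:]" using \<open>degree P = 0\<close> degree_eq_zeroE by blast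
    then have "1 \<le> \<bar>c\<bar>" using that(1) by auto
    moreover have "eval_at P \<zeta> = c" by (simp add: c eval_at_sum)
    ultimately have 1: "1 \<le> \<bar>eval_at P \<zeta>\<bar>" by simp
    have "1 \<le> mahler_measure P powr w" using mahler_measure_poly_ge_1[OF that(1)] w by (simp add: ge_one_powr_ge_zero)
    with 1 have "1 * 1 \<le> f P" unfolding f_def by (intro mult_mono) auto
    then show ?thesis by simp
  qed
  \<comment> \<open>A positive lower bound for \<open>f\<close> on all irreducible nonconstant
    polynomials of degree at most \<open>m\<close>: those outside the finite set have f > 1, and
    inserting 1 keeps \<delta> \<le> 1.\<close>
  define \<delta> where "\<delta> = Min (insert 1 (f ` ?S))"
  have \<delta>1: "\<delta> \<le> 1" unfolding \<delta>_def using fin by (intro Min_le) auto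
  have \<delta>0: "0 < \<delta>" unfolding \<delta>_def using fin f_pos by (subst Min_gr_iff) auto
  have \<delta>S: "\<delta> \<le> f P" if "irreducible P" "0 < degree P" "degree P \<le> m" for P
  proof (cases "f P \<le> 1")
    case True
    then have "P \<in> ?S" using that by (simp add: f_def)
    then show ?thesis unfolding \<delta>_def using fin by (intro Min_le) auto
  qed (use \<delta>1 in linarith)
  \<comment> \<open>Nonconstant prime factors contribute at least \<delta> each and number at most
    the degree; constant factors contribute at least 1.\<close>
  have low: "P \<noteq> 0 \<longrightarrow> degree P \<le> m \<longrightarrow> \<delta> ^ degree P \<le> f P" for P
  proof (induction P rule: prime_divisors_induct)
    case (unit P)
    then have "P \<noteq> 0" "degree P = 0" by (auto simp: is_unit_poly_iff)
    then show ?case using f_const by simp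
  next
    case (factor p x)
    show ?case
    proof (intro impI)
      assume px: "p * x \<noteq> 0" and "degree (p * x) \<le> m"
      then have deg: "degree p + degree x \<le> m" by (simp add: degree_mult_eq)
      have x: "\<delta> ^ degree x \<le> f x" using factor px deg by simp
      have p: "\<delta> ^ degree p \<le> f p"
      proof (cases "degree p = 0")
        case True
        then show ?thesis using f_const px by simp
      next
        case False
        then have "\<delta> ^ degree p \<le> \<delta> ^ 1" using \<delta>0 \<delta>1 by (intro power_decreasing) auto
        also have "\<dots> \<le> f p"
          using False deg \<delta>S[OF prime_elem_imp_irreducible[OF prime_imp_prime_elem[OF factor(1)]]]
          by simp
        finally show ?thesis .
      qed
      show "\<delta> ^ degree (p * x) \<le> f (p * x)"
        unfolding f_mult using px x p \<delta>0 f_pos[of p]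
        by (simp add: degree_mult_eq power_add mult_mono less_imp_le)
    qed
  qed simp
  obtain w' where w': "w < w'" and inf: "infinite {P. degree P \<le> m \<and> 0 < \<bar>eval_at P \<zeta>\<bar> \<and>
                  \<bar>eval_at P \<zeta>\<bar> \<le> real_of_int (height P) powr (- w')}" (is "infinite ?T")
    using w(2) unfolding w_exp_def less_Sup_iff by auto
  \<comment> \<open>For \<open>P\<close> in the infinite set, \<delta>^m \<le> f(P) \<le> (m + 1)^w
    H(P)^(w - w'). Solving for H(P) gives the bound \<open>R\<close>, so only finitely many
    \<open>P\<close> would remain.\<close>
  define R where "R = ((real m + 1) powr w / \<delta> ^ m) powr (1 / (w' - w))"
  have "?T \<subseteq> {P. degree P \<le> m \<and> height P \<le> \<lfloor>R\<rfloor>}"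
  proof clarify
    fix P assume P: "degree P \<le> m" "0 < \<bar>eval_at P \<zeta>\<bar>" "\<bar>eval_at P \<zeta>\<bar> \<le> real_of_int (height P) powr (- w')"
    then have P0: "P \<noteq> 0" by auto
    define H where "H = real_of_int (height P)"
    have H: "1 \<le> H" using height_ge_1[OF P0] by (simp add: H_def)
    have "\<delta> ^ m \<le> \<delta> ^ degree P" using \<delta>0 \<delta>1 P(1) by (intro power_decreasing) auto
    also have "\<dots> \<le> f P" using low P(1) P0 by blast
    also have "\<dots> \<le> H powr (- w') * ((real m + 1) * H) powr w"
      unfolding f_def H_def using P mahler_measure_le_height[OF P(1)] w mahler_measure_ge_0
      by (intro mult_mono powr_mono2) auto
    also have "\<dots> = (real m + 1) powr w * H powr (w - w')"
      using H powr_mult[of "real m + 1" H w] by (simp add: powr_diff powr_minus divide_inverse)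
    finally have "\<delta> ^ m * H powr (w' - w) \<le> (real m + 1) powr w * (H powr (w - w') * H powr (w' - w))"
      by (simp add: mult_right_mono flip: mult.assoc)
    then have "\<delta> ^ m * H powr (w' - w) \<le> (real m + 1) powr w" using H by (simp flip: powr_add)
    then have "H powr (w' - w) \<le> (real m + 1) powr w / \<delta> ^ m" using \<delta>0 by (simp add: field_simps)
    then have "(H powr (w' - w)) powr (1 / (w' - w)) \<le> R"
      unfolding R_def using w' by (intro powr_mono2) auto
    then have "H \<le> R" using w' H by (simp add: powr_powr)
    then show "height P \<le> \<lfloor>R\<rfloor>" by (simp add: H_def le_floor_iff)
  qed
  then have "finite ?T" using finite_bounded_height by (rule finite_subset)
  with inf show False by simp
qed

section \<open>Coprime polynomials and common solutions of their recurrences\<close>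

text \<open>A nonzero element of least degree in the ideal generated by \<open>p\<close> and
  \<open>q\<close> divides both, by division with remainder. Irreducibility of \<open>p\<close> then
  forces it to be a unit.\<close>

lemma field_poly_bezout:
  fixes p q :: "'a :: field poly"
  assumes irr: "irreducible p" and ndvd: "\<not> p dvd q"
  obtains a b where "a * p + b * q = 1"
proof -
  define I where "I g \<longleftrightarrow> g \<noteq> 0 \<and> (\<exists>a b. g = a * p + b * q)" for g
  have "p \<noteq> 0" using irr by (auto simp: irreducible_def)
  moreover have "p = 1 * p + 0 * q" by simp
  ultimately have "I p" unfolding I_def by blast
  then obtain g where g: "I g" "\<And>h. I h \<Longrightarrow> degree g \<le> degree h"
    using ex_has_least_nat[of I p degree] by blast
  obtain a b where ab: "g = a * p + b * q" and g0: "g \<noteq> 0" using g(1) by (auto simp: I_def)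
  have dvd: "g dvd h" if "h = c * p + d * q" for h c d
  proof (rule ccontr)
    assume nd: "\<not> g dvd h"
    then have nz: "h mod g \<noteq> 0" by (simp add: dvd_eq_mod_eq_0)
    have "h mod g = h - (h div g) * g" by (simp add: minus_div_mult_eq_mod)
    also have "\<dots> = (c - (h div g) * a) * p + (d - (h div g) * b) * q"
      by (simp add: that ab algebra_simps)
    finally have "I (h mod g)" unfolding I_def using nz by blast
    then have "degree g \<le> degree (h mod g)" by (rule g(2))
    moreover have "degree (h mod g) < degree g"
      using degree_mod_less[OF g0, of h] nz by auto
    ultimately show False by simp
  qed
  have "g dvd p" by (rule dvd[of _ 1 0]) simp
  moreover have "g dvd q" by (rule dvd[of _ 0 1]) simp
  moreover have "\<not> p dvd g" using \<open>g dvd q\<close> ndvd dvd_trans by blast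
  ultimately have "is_unit g" using irreducibleD'[OF irr, of g] by blast
  then obtain c where "1 = g * c" by (rule dvdE)
  then have "(c * a) * p + (c * b) * q = 1" using ab by (simp add: algebra_simps)
  then show ?thesis by (rule that)
qed

text \<open>Reducing the cofactor of \<open>q\<close> modulo \<open>p\<close> gives it degree below
  degree p, so its product with \<open>q\<close> has degree at most \<open>N\<close>. The other
  product is the monomial minus this one and has degree at most \<open>N\<close> too.\<close>

lemma monom_combination:
  fixes p q :: "'a :: field poly"
  assumes ab: "a * p + b * q = 1" and p: "p \<noteq> 0" and pos: "0 < degree p"
    and deg: "degree p + degree q \<le> N + 1" and k: "k \<le> N"
  obtains c d where "monom 1 k = c * p + d * q" "c \<noteq> 0 \<Longrightarrow> degree c + degree p \<le> N"
    "d \<noteq> 0 \<Longrightarrow> degree d + degree q \<le> N"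
proof -
  define d where "d = (monom 1 k * b) mod p"
  define c where "c = monom 1 k * a + q * ((monom 1 k * b) div p)"
  have "monom 1 k = monom 1 k * (a * p + b * q)" by (simp add: ab)
  also have "\<dots> = monom 1 k * a * p + (monom 1 k * b) * q" by (simp add: algebra_simps)
  also have "monom 1 k * b = ((monom 1 k * b) div p) * p + d" by (simp add: d_def)
  also have "monom 1 k * a * p + (((monom 1 k * b) div p) * p + d) * q = c * p + d * q"
    by (simp add: c_def algebra_simps)
  finally have eq: "monom 1 k = c * p + d * q" .
  have dd: "degree d < degree p" using degree_mod_less[OF p, of "monom 1 k * b"] pos by (auto simp: d_def)
  have "degree (c * p) \<le> N"
  proof -
    have "c * p = monom 1 k - d * q" using eq by simp
    moreover have "degree (monom (1::'a) k) \<le> N" using k degree_monom_le le_trans by blast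
    moreover have "degree (d * q) \<le> N" using degree_mult_le[of d q] dd deg by linarith
    ultimately show ?thesis by (metis degree_diff_le)
  qed
  then have "c \<noteq> 0 \<Longrightarrow> degree c + degree p \<le> N" using p by (simp add: degree_mult_eq)
  moreover have "d \<noteq> 0 \<Longrightarrow> degree d + degree q \<le> N" using dd deg by linarith
  ultimately show ?thesis using that eq by blast
qed

text \<open>By Gauss's lemma \<open>P\<close> stays irreducible, and no divisor of \<open>Q\<close>,
  over the fraction field. Hence T^k is a combination of shifts of \<open>P\<close> and
  \<open>Q\<close> of degree at most \<open>N\<close>, all of which are annihilated by the
  functional T^i \<mapsto> y_i; so it sends T^k to 0.\<close>

lemma sequence_zero_of_coprime_recurrences:
  assumes irr: "irreducible P" "0 < degree P" and ndvd: "\<not> P dvd Q"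
    and deg: "degree P + degree Q \<le> N + 1"
    and P: "\<And>j. degree P + j \<le> N \<Longrightarrow> poly_form P y j = 0"
    and Q: "\<And>j. degree Q + j \<le> N \<Longrightarrow> poly_form Q y j = 0"
    and k: "k \<le> N"
  shows "y k = 0"
proof -
  let ?p = "map_poly to_fract P" and ?q = "map_poly to_fract Q"
  have irr': "irreducible ?p" "content P = 1"
    using nonconst_poly_irreducible_iff[of P] irr by auto
  have "\<not> ?p dvd ?q" using fract_poly_dvdD[of P Q] irr'(2) ndvd by blast
  then obtain a b where "a * ?p + b * ?q = 1" by (rule field_poly_bezout[OF irr'(1)])
  moreover have dp: "degree ?p = degree P" "degree ?q = degree Q" by (auto simp: degree_map_poly)
  moreover have "?p \<noteq> 0" using irr by auto
  ultimately obtain c d where cd: "monom 1 k = c * ?p + d * ?q" "c \<noteq> 0 \<Longrightarrow> degree c + degree P \<le> N"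
    "d \<noteq> 0 \<Longrightarrow> degree d + degree Q \<le> N"
    using monom_combination[of a ?p b ?q N k] irr deg k by auto
  \<comment> \<open>The functional extended to coefficients in the fraction field, where the Bezout
    cofactors live.\<close>
  define L where "L R = (\<Sum>i\<le>N. coeff R i * to_fract (y i))" for R :: "int fract poly"
  have L_add: "L (R + S) = L R + L S" for R S by (simp add: L_def sum.distrib algebra_simps)
  have L_smult: "L (smult s R) = s * L R" for s R by (simp add: L_def sum_distrib_left mult.assoc)
  have L_sum: "L (sum g A) = (\<Sum>j\<in>A. L (g j))" if "finite A" for g and A :: "nat set"
    using that by induction (auto simp: L_add, simp add: L_def)
  have to_fract_sum: "(\<Sum>i\<in>A. to_fract (g i)) = to_fract (sum g A)" for g :: "nat \<Rightarrow> int" and A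
    by (induction A rule: infinite_finite_induct) auto
  have L_shift: "L (monom 1 j * map_poly to_fract R) = to_fract (poly_form R y j)"
    if "degree R + j \<le> N" for R j
  proof -
    have "L (monom 1 j * map_poly to_fract R)
       = (\<Sum>i\<le>N. if j \<le> i then to_fract (coeff R (i - j) * y i) else 0)"
      unfolding L_def by (intro sum.cong refl) (simp add: coeff_monom_mult coeff_map_poly)
    also have "\<dots> = (\<Sum>i\<in>{j..degree R + j}. to_fract (coeff R (i - j) * y i))"
      using that by (intro sum.mono_neutral_cong_right) (auto simp: coeff_eq_0)
    also have "\<dots> = (\<Sum>i\<le>degree R. to_fract (coeff R i * y (i + j)))"
      by (rule sum.reindex_bij_witness[of _ "\<lambda>i. i + j" "\<lambda>i. i - j"]) auto
    also have "\<dots> = to_fract (poly_form R y j)"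
      unfolding poly_form_def by (rule to_fract_sum)
    finally show ?thesis .
  qed
  have L_mult: "L (s * map_poly to_fract R) = 0"
    if "s \<noteq> 0 \<Longrightarrow> degree s + degree R \<le> N" "\<And>j. degree R + j \<le> N \<Longrightarrow> poly_form R y j = 0" for s R
  proof (cases "s = 0")
    case True
    then show ?thesis by (simp add: L_def)
  next
    case False
    have "s = (\<Sum>j\<le>degree s. monom (coeff s j) j)" by (simp add: poly_as_sum_of_monoms)
    then have "s * map_poly to_fract R = (\<Sum>j\<le>degree s. smult (coeff s j) (monom 1 j * map_poly to_fract R))"
      by (metis (no_types, lifting) sum.cong sum_distrib_right mult_smult_left smult_monom mult.right_neutral)
    then have "L (s * map_poly to_fract R) = (\<Sum>j\<le>degree s. coeff s j * L (monom 1 j * map_poly to_fract R))"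
      by (simp add: L_sum L_smult)
    also have "\<dots> = 0" using that(1)[OF False] that(2) by (intro sum.neutral) (auto simp: L_shift)
    finally show ?thesis .
  qed
  have "L (monom 1 k) = 0" unfolding cd(1) L_add using L_mult cd(2,3) P Q by simp
  moreover have "L (monom 1 k) = to_fract (y k)"
    using k by (simp add: L_def if_distrib[of "\<lambda>x. x * _"] cong: if_cong)
  ultimately show ?thesis by simp
qed

section \<open>An upper bound for the uniform exponent of simultaneous approximation\<close>

text \<open>Suppose an exponent l > 1 / v were admissible. Take \<open>P\<close> irreducible of
  large height H, \<open>Q\<close> of height at most c H, and an approximation with |x| \<le>
  H^\<mu>. All forms of \<open>P\<close> and \<open>Q\<close> are then integers below 1 in absolute
  value, hence 0, and coprimality forces x = 0.\<close>

lemma lambda_hat_exp_le: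
  fixes \<zeta> v :: real
  assumes tr: "\<not> algebraic \<zeta>" and N: "1 \<le> N" "m + n \<le> N + 1"
    and v: "0 < v" "ereal v < w_exp m \<zeta>" "ereal v < w_hat_exp n \<zeta>"
  shows "lambda_hat_exp N \<zeta> \<le> ereal (1 / v)"
  unfolding lambda_hat_exp_def
proof (rule Sup_least, elim CollectE exE conjE, rule ccontr)
  fix l' l assume l': "l' = ereal l" "\<not> l' \<le> ereal (1 / v)"
    and l: "\<forall>\<^sub>F X :: real in at_top. \<exists>(x :: int) (y :: nat \<Rightarrow> int).
        1 \<le> \<bar>x\<bar> \<and> real_of_int \<bar>x\<bar> \<le> X \<and>
        (MAX i\<in>{1..N}. \<bar>\<zeta> ^ i * real_of_int x - real_of_int (y i)\<bar>) \<le> X powr (- l)"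
  have lv: "1 / v < l" using l' by simp
  have "0 < 1 / v" using v(1) by simp
  then have l0: "0 < l" using lv by linarith
  have "1 / l < v" using lv l0 v(1) by (simp add: field_simps)
  \<comment> \<open>With 1 / l < \<mu> < v both exponents \<mu> - v and 1 - \<mu> l of the form
    bound are negative.\<close>
  then obtain \<mu> where \<mu>: "1 / l < \<mu>" "\<mu> < v" using dense by blast
  have "0 < 1 / l" using l0 by simp
  then have \<mu>0: "0 < \<mu>" using \<mu>(1) by linarith
  have \<mu>l: "1 - \<mu> * l < 0" using \<mu>(1) l0 by (simp add: field_simps)
  define Z where "Z = max 1 \<bar>\<zeta>\<bar>"
  have Z: "1 \<le> Z" "\<bar>\<zeta>\<bar> \<le> Z" by (auto simp: Z_def)
  \<comment> \<open>If \<open>P\<close> divided \<open>Q\<close>, monotonicity of the Mahler measure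
    would give H(P) \<le> 2^m (n + 1) H(Q). With this \<open>c\<close> the right side is at most
    H(P) / 2.\<close>
  define c where "c = 1 / (2 * 2 ^ m * (real n + 1))"
  have c: "0 < c" "c \<le> 1"
  proof -
    have "1 * 1 * 1 \<le> 2 * 2 ^ m * (real n + 1)" by (intro mult_mono) auto
    then show "c \<le> 1" by (simp add: c_def)
  qed (simp add: c_def)
  define E where "E K H = K * H powr (\<mu> - v) + (real N + 1) * H powr (1 - \<mu> * l)" for K H :: real
  have E: "\<forall>\<^sub>F H in at_top. E K H < 1" for K
  proof (rule order_tendstoD(2))
    show "(E K \<longlongrightarrow> K * 0 + (real N + 1) * 0) at_top"
      unfolding E_def using \<mu>(2) \<mu>l by (intro tendsto_intros tendsto_neg_powr filterlim_ident) auto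
  qed simp
  \<comment> \<open>\<open>K1\<close> pays for replacing the Mahler measure of \<open>P\<close> by
    its height, \<open>K2\<close> for replacing c H by H in the bound for \<open>Q\<close>.\<close>
  define K1 where "K1 = Z ^ N * (2 ^ m) powr v"
  define K2 where "K2 = Z ^ N * c powr (- v)"
  have f1: "filterlim (\<lambda>H. c * H) at_top at_top" using c by real_asymp
  have f2: "filterlim (\<lambda>H :: real. H powr \<mu>) at_top at_top" using \<mu>0 by real_asymp
  have "\<forall>\<^sub>F H in at_top. E K1 H < 1 \<and> E K2 H < 1 \<and>
     (\<exists>P. degree P \<le> n \<and> real_of_int (height P) \<le> c * H \<and>
           0 < \<bar>eval_at P \<zeta>\<bar> \<and> \<bar>eval_at P \<zeta>\<bar> \<le> (c * H) powr (- v)) \<and>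
     (\<exists>(x :: int) (y :: nat \<Rightarrow> int). 1 \<le> \<bar>x\<bar> \<and> real_of_int \<bar>x\<bar> \<le> H powr \<mu> \<and>
        (MAX i\<in>{1..N}. \<bar>\<zeta> ^ i * real_of_int x - real_of_int (y i)\<bar>) \<le> (H powr \<mu>) powr (- l))"
    by (intro eventually_conj E eventually_compose_filterlim[OF less_w_hat_expD[OF v(3)] f1]
          eventually_compose_filterlim[OF l f2])
  then obtain H0 where H0: "\<And>H. H0 \<le> H \<Longrightarrow> E K1 H < 1 \<and> E K2 H < 1 \<and>
     (\<exists>P. degree P \<le> n \<and> real_of_int (height P) \<le> c * H \<and>
           0 < \<bar>eval_at P \<zeta>\<bar> \<and> \<bar>eval_at P \<zeta>\<bar> \<le> (c * H) powr (- v)) \<and>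
     (\<exists>(x :: int) (y :: nat \<Rightarrow> int). 1 \<le> \<bar>x\<bar> \<and> real_of_int \<bar>x\<bar> \<le> H powr \<mu> \<and>
        (MAX i\<in>{1..N}. \<bar>\<zeta> ^ i * real_of_int x - real_of_int (y i)\<bar>) \<le> (H powr \<mu>) powr (- l))"
    unfolding eventually_at_top_linorder by blast
  let ?S = "{P. irreducible P \<and> 0 < degree P \<and> degree P \<le> m \<and>
                      \<bar>eval_at P \<zeta>\<bar> * mahler_measure P powr v \<le> 1}"
  have "infinite ?S" using irreducible_approximations[OF tr _ v(2)] v(1) by simp
  then have "\<not> ?S \<subseteq> {P. degree P \<le> m \<and> height P \<le> \<lceil>H0\<rceil>}"
    using finite_bounded_height finite_subset by blast
  then obtain P where P: "irreducible P" "0 < degree P" "degree P \<le> m"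
      "\<bar>eval_at P \<zeta>\<bar> * mahler_measure P powr v \<le> 1" "\<lceil>H0\<rceil> < height P"
    by fastforce
  define H where "H = real_of_int (height P)"
  have "H0 \<le> H" using P(5) unfolding H_def by linarith
  note H = H0[OF this]
  have P0: "P \<noteq> 0" using P(2) by auto
  have H1: "1 \<le> H" using height_ge_1[OF P0] by (simp add: H_def)
  obtain Q where Q: "degree Q \<le> n" "real_of_int (height Q) \<le> c * H"
      "0 < \<bar>eval_at Q \<zeta>\<bar>" "\<bar>eval_at Q \<zeta>\<bar> \<le> (c * H) powr (- v)" using H by blast
  have Q0: "Q \<noteq> 0" using Q(3) by auto
  obtain x :: int and y :: "nat \<Rightarrow> int" where xy: "1 \<le> \<bar>x\<bar>" "real_of_int \<bar>x\<bar> \<le> H powr \<mu>"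
      "(MAX i\<in>{1..N}. \<bar>\<zeta> ^ i * real_of_int x - real_of_int (y i)\<bar>) \<le> (H powr \<mu>) powr (- l)"
    using H by blast
  define z where "z i = (if i = 0 then x else y i)" for i
  have err: "\<bar>real_of_int (z i) - \<zeta> ^ i * real_of_int x\<bar> \<le> H powr (- (\<mu> * l))" if "i \<le> N" for i
  proof (cases "i = 0")
    case False
    then have "\<bar>\<zeta> ^ i * real_of_int x - real_of_int (y i)\<bar>
        \<le> (MAX i\<in>{1..N}. \<bar>\<zeta> ^ i * real_of_int x - real_of_int (y i)\<bar>)"
      using that by (intro Max_ge) auto
    then show ?thesis using False xy(3) by (simp add: z_def powr_powr abs_minus_commute)
  qed (simp add: z_def)
  \<comment> \<open>A form with integer value below 1 in absolute value is 0; \<open>E K H\<close>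
    is the bound from \<open>poly_form_bound\<close>.\<close>
  have vanish: "poly_form R z j = 0"
    if R: "degree R + j \<le> N" "height R \<le> H" "Z ^ N * \<bar>eval_at R \<zeta>\<bar> \<le> K * H powr (- v)" "E K H < 1" for R j K
  proof -
    have "\<bar>real_of_int (poly_form R z j)\<bar>
       \<le> \<bar>real_of_int x\<bar> * Z ^ N * \<bar>eval_at R \<zeta>\<bar> + (real N + 1) * height R * H powr (- (\<mu> * l))"
      using err R(1) Z by (intro poly_form_bound) auto
    also have "\<dots> \<le> H powr \<mu> * (K * H powr (- v)) + (real N + 1) * H * H powr (- (\<mu> * l))"
    proof (rule add_mono)
      have "\<bar>real_of_int x\<bar> * (Z ^ N * \<bar>eval_at R \<zeta>\<bar>) \<le> H powr \<mu> * (K * H powr (- v))"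
        using xy(2) Z by (intro mult_mono[OF _ R(3)]) auto
      then show "\<bar>real_of_int x\<bar> * Z ^ N * \<bar>eval_at R \<zeta>\<bar> \<le> H powr \<mu> * (K * H powr (- v))"
        by (simp add: mult.assoc)
    qed (use R(2) in \<open>intro mult_right_mono mult_left_mono, auto\<close>)
    also have "\<dots> = E K H"
      using H1 powr_add[of H \<mu> "- v"] powr_add[of H 1 "- (\<mu> * l)"] by (simp add: E_def)
    also have "\<dots> < 1" by (rule R)
    finally show ?thesis by linarith
  qed
  have "Z ^ N * \<bar>eval_at P \<zeta>\<bar> \<le> K1 * H powr (- v)"
  proof -
    have "H \<le> 2 ^ m * mahler_measure P" using height_le_mahler_measure[OF P(3)] by (simp add: H_def)
    then have "H powr v \<le> (2 ^ m * mahler_measure P) powr v" using H1 v by (intro powr_mono2) auto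
    also have "\<dots> = (2 ^ m) powr v * mahler_measure P powr v"
      by (simp add: powr_mult mahler_measure_ge_0)
    finally have "\<bar>eval_at P \<zeta>\<bar> * H powr v \<le> \<bar>eval_at P \<zeta>\<bar> * ((2 ^ m) powr v * mahler_measure P powr v)"
      by (intro mult_left_mono) auto
    also have "\<dots> = (2 ^ m) powr v * (\<bar>eval_at P \<zeta>\<bar> * mahler_measure P powr v)" by simp
    also have "\<dots> \<le> (2 ^ m) powr v * 1" using P(4) by (intro mult_left_mono) auto
    finally have "\<bar>eval_at P \<zeta>\<bar> \<le> (2 ^ m) powr v * H powr (- v)"
      using H1 by (simp add: powr_minus field_simps)
    then show ?thesis unfolding K1_def mult.assoc using Z by (intro mult_left_mono) auto
  qed
  then have vP: "poly_form P z j = 0" if "degree P + j \<le> N" for j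
    using vanish[OF that] H by (simp add: H_def)
  have "Z ^ N * \<bar>eval_at Q \<zeta>\<bar> \<le> K2 * H powr (- v)"
    using Q(4) c H1 Z by (simp add: K2_def powr_mult mult.assoc)
  moreover have "height Q \<le> H" using Q(2) c H1 by (smt (verit) mult_left_le_one_le)
  ultimately have vQ: "poly_form Q z j = 0" if "degree Q + j \<le> N" for j
    using vanish[OF that] H by simp
  have "\<not> P dvd Q"
  proof
    assume "P dvd Q"
    have "H \<le> 2 ^ m * mahler_measure P" using height_le_mahler_measure[OF P(3)] by (simp add: H_def)
    also have "\<dots> \<le> 2 ^ m * mahler_measure Q"
      using mahler_measure_dvd[OF Q0 \<open>P dvd Q\<close>] by (intro mult_left_mono) auto
    also have "\<dots> \<le> 2 ^ m * ((real n + 1) * height Q)"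
      using mahler_measure_le_height[OF Q(1)] by (intro mult_left_mono) auto
    also have "\<dots> \<le> 2 ^ m * ((real n + 1) * (c * H))"
      using Q(2) by (intro mult_left_mono) auto
    also have "\<dots> = (2 ^ m * (real n + 1)) / (2 * (2 ^ m * (real n + 1))) * H" by (simp add: c_def)
    also have "\<dots> = H / 2"
    proof -
      have half: "x / (2 * x) * H = H / 2" if "0 < x" for x using that by simp
      show ?thesis by (rule half, intro mult_pos_pos) auto
    qed
    finally show False using H1 by simp
  qed
  then have "z 0 = 0"
    using P Q N vP vQ by (intro sequence_zero_of_coprime_recurrences[of P Q N z 0]) auto
  then show False using xy(1) by (simp add: z_def)
qed

section \<open>Bounds for the uniform exponents at a fixed degree\<close>

lemma eval_at_sum_le:
  assumes "degree P \<le> n"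
  shows "eval_at P \<zeta> = (\<Sum>i\<le>n. real_of_int (coeff P i) * \<zeta> ^ i)"
  unfolding eval_at_sum using assms
  by (intro sum.mono_neutral_left) (auto simp: coeff_eq_0)

text \<open>Dirichlet's box principle: the (K + 1)^(n + 1) coefficient vectors with entries from 0
  to K have values in an interval that is cut into K^(n + 1) pieces. Two vectors share a piece, and
  their difference is not 0 at \<zeta> by transcendence.\<close>

lemma w_hat_exp_ge:
  fixes \<zeta> :: real
  assumes tr: "\<not> algebraic \<zeta>"
  shows "ereal (real n) \<le> w_hat_exp n \<zeta>"
proof (rule ereal_le_of_less, rule w_hat_exp_geI)
  fix l assume l: "l < real n"
  define Z where "Z = max 1 \<bar>\<zeta>\<bar>"
  have Z: "1 \<le> Z" "\<bar>\<zeta>\<bar> \<le> Z" by (auto simp: Z_def)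
  define C where "C = (real n + 1) * Z ^ n"
  have "1 * 1 \<le> C" unfolding C_def using Z by (intro mult_mono) auto
  then have C: "1 \<le> C" by simp
  have "\<forall>\<^sub>F X in at_top. 3 * C * (X / 2) powr (- real n) \<le> X powr (- l)"
    using l C by real_asymp
  moreover have "\<forall>\<^sub>F X :: real in at_top. 2 \<le> X" by (rule eventually_ge_at_top)
  ultimately show "\<forall>\<^sub>F X :: real in at_top. \<exists>P. degree P \<le> n \<and> real_of_int (height P) \<le> X \<and>
           0 < \<bar>eval_at P \<zeta>\<bar> \<and> \<bar>eval_at P \<zeta>\<bar> \<le> X powr (- l)"
  proof eventually_elim
    case (elim X)
    define K where "K = nat \<lfloor>X\<rfloor>"
    have K: "real K \<le> X" "X / 2 \<le> real K" "1 \<le> K" using elim(2) unfolding K_def by linarith+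
    define B where "B = C * K"
    have "1 * 1 \<le> B" unfolding B_def using C K by (intro mult_mono) auto
    then have B: "1 \<le> B" by simp
    define A where "A = ({..n} \<rightarrow>\<^sub>E {..K})"
    define val where "val a = (\<Sum>i\<le>n. real (a i) * \<zeta> ^ i)" for a :: "nat \<Rightarrow> nat"
    \<comment> \<open>The reciprocal of the length of a piece. The summand 1 in 2 B + 1 keeps the
      shifted values strictly inside the last piece.\<close>
    define s where "s = real K ^ (n + 1) / (2 * B + 1)"
    have s: "0 < s" unfolding s_def using K B by auto
    define box where "box a = \<lfloor>(val a + B) * s\<rfloor>" for a
    have val: "\<bar>val a\<bar> \<le> B" if "a \<in> A" for a
    proof -
      have "\<bar>val a\<bar> \<le> (\<Sum>i\<le>n. \<bar>real (a i) * \<zeta> ^ i\<bar>)" unfolding val_def by (rule sum_abs)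
      also have "\<dots> \<le> (\<Sum>i\<le>n. real K * Z ^ n)"
      proof (rule sum_mono)
        fix i assume i: "i \<in> {..n}"
        then have "a i \<le> K" using that by (auto simp: A_def)
        moreover have "\<bar>\<zeta> ^ i\<bar> \<le> Z ^ i" unfolding power_abs using Z by (intro power_mono) auto
        moreover have "Z ^ i \<le> Z ^ n" using Z i by (intro power_increasing) auto
        ultimately show "\<bar>real (a i) * \<zeta> ^ i\<bar> \<le> real K * Z ^ n"
          unfolding abs_mult by (intro mult_mono) auto
      qed
      also have "\<dots> = B" by (simp add: B_def C_def)
      finally show ?thesis .
    qed
    have "box ` A \<subseteq> {0..<int (K ^ (n + 1))}"
    proof
      fix b assume "b \<in> box ` A"
      then obtain a where a: "a \<in> A" "b = box a" by blast
      have "0 \<le> (val a + B) * s" using val[OF a(1)] s by auto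
      moreover have "(val a + B) * s < (2 * B + 1) * s"
        using val[OF a(1)] s by (intro mult_strict_right_mono) auto
      moreover have "(2 * B + 1) * s = real (K ^ (n + 1))" using B by (simp add: s_def)
      ultimately show "b \<in> {0..<int (K ^ (n + 1))}"
        unfolding a(2) box_def by (simp add: floor_less_iff)
    qed
    then have "card (box ` A) \<le> card {0..<int (K ^ (n + 1))}" by (intro card_mono) auto
    also have "\<dots> = K ^ (n + 1)" by (simp only: card_atLeastLessThan_int diff_zero nat_int)
    also have "\<dots> < (K + 1) ^ (n + 1)" by (intro power_strict_mono) auto
    also have "\<dots> = card A" by (simp add: A_def card_PiE)
    finally have "\<not> inj_on box A" by (rule pigeonhole)
    then obtain a b where ab: "a \<in> A" "b \<in> A" "a \<noteq> b" "box a = box b" by (auto simp: inj_on_def)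
    define P where "P = (\<Sum>i\<le>n. monom (int (a i) - int (b i)) i)"
    have coeff: "coeff P i = (if i \<le> n then int (a i) - int (b i) else 0)" for i
      by (simp add: P_def coeff_sum)
    have deg: "degree P \<le> n" by (rule degree_le) (simp add: coeff)
    have ht: "height P \<le> int K"
      unfolding height_le_iff using ab(1,2) by (auto simp: coeff A_def PiE_def Pi_def abs_le_iff)
    obtain i where i: "a i \<noteq> b i" using ab(3) by auto
    then have "i \<le> n" using ab(1,2) by (cases "i \<le> n") (auto simp: A_def PiE_def extensional_def)
    then have "coeff P i \<noteq> 0" using i by (simp add: coeff)
    then have "P \<noteq> 0" by auto
    then have nz: "0 < \<bar>eval_at P \<zeta>\<bar>" using eval_at_nonzero[OF tr] by simp
    have "eval_at P \<zeta> = val a - val b"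
      unfolding eval_at_sum_le[OF deg] val_def by (simp add: coeff sum_subtractf algebra_simps)
    then have "\<bar>eval_at P \<zeta>\<bar> * s = \<bar>(val a + B) * s - (val b + B) * s\<bar>"
      using s by (simp add: abs_mult flip: left_diff_distrib)
    also have "\<dots> \<le> 1" using ab(4) unfolding box_def by linarith
    finally have "\<bar>eval_at P \<zeta>\<bar> \<le> 1 / s" using s by (simp add: field_simps)
    also have "1 / s = (2 * B + 1) / real K ^ (n + 1)" by (simp add: s_def)
    also have "\<dots> \<le> (3 * B) / real K ^ (n + 1)" using B by (intro divide_right_mono) auto
    also have "\<dots> = 3 * C * real K powr (- real n)"
      using K by (simp add: B_def powr_minus powr_realpow field_simps)
    also have "\<dots> \<le> 3 * C * (X / 2) powr (- real n)"
      using K elim(2) C by (intro mult_left_mono powr_mono2') auto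
    also have "\<dots> \<le> X powr (- l)" by (rule elim)
    finally show ?case using deg ht K nz by (intro exI[of _ P]) auto
  qed
qed

text \<open>For a positive \<open>u\<close> between the two exponents only finitely many polynomials
  satisfy |P(\<zeta>)| \<le> H(P)^(-u). Their values stay away from 0, so none of them can serve for
  large X.\<close>

lemma w_hat_exp_le_w_exp:
  fixes \<zeta> :: real
  assumes tr: "\<not> algebraic \<zeta>" and n: "1 \<le> n"
  shows "w_hat_exp n \<zeta> \<le> w_exp n \<zeta>"
proof (rule ccontr)
  assume "\<not> w_hat_exp n \<zeta> \<le> w_exp n \<zeta>"
  then have "max 0 (w_exp n \<zeta>) < w_hat_exp n \<zeta>"
    using w_hat_exp_ge[OF tr, of n] n by (auto intro: less_le_trans[of 0 "ereal (real n)"])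
  then obtain u where u: "max 0 (w_exp n \<zeta>) < ereal u" "ereal u < w_hat_exp n \<zeta>"
    using ereal_dense2 by blast
  then have u0: "0 < u" by simp
  let ?T = "{P. degree P \<le> n \<and> 0 < \<bar>eval_at P \<zeta>\<bar> \<and> \<bar>eval_at P \<zeta>\<bar> \<le> real_of_int (height P) powr (- u)}"
  have "finite ?T"
  proof (rule ccontr)
    assume "infinite ?T"
    then have "ereal u \<le> w_exp n \<zeta>" unfolding w_exp_def by (intro Sup_upper CollectI exI[of _ u] conjI refl)
    with u(1) show False by (simp add: not_less[symmetric])
  qed
  define \<epsilon> where "\<epsilon> = Min (insert 1 ((\<lambda>P. \<bar>eval_at P \<zeta>\<bar>) ` ?T))"
  have \<epsilon>: "0 < \<epsilon>" unfolding \<epsilon>_def using \<open>finite ?T\<close> by (subst Min_gr_iff) auto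
  have "\<forall>\<^sub>F X in at_top. X powr (- u) < \<epsilon>" using u0 \<epsilon> by real_asymp
  with less_w_hat_expD[OF u(2)] have "\<forall>\<^sub>F X :: real in at_top. False"
  proof eventually_elim
    case (elim X)
    then obtain P where P: "degree P \<le> n" "real_of_int (height P) \<le> X" "0 < \<bar>eval_at P \<zeta>\<bar>"
       "\<bar>eval_at P \<zeta>\<bar> \<le> X powr (- u)" by blast
    have "P \<noteq> 0" using P(3) by auto
    then have "1 \<le> real_of_int (height P)" using height_ge_1 by simp
    then have "X powr (- u) \<le> real_of_int (height P) powr (- u)" using P(2) u0 by (intro powr_mono2') auto
    then have "P \<in> ?T" using P by auto
    then have "\<epsilon> \<le> \<bar>eval_at P \<zeta>\<bar>" unfolding \<epsilon>_def using \<open>finite ?T\<close> by (intro Min_le) auto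
    then show False using P(4) elim(2) by linarith
  qed
  then show False by simp
qed

text \<open>Compare the two estimates for \<open>lambda_hat_exp N\<close> at N = 2 n - 1: the upper
  one, with both degrees equal to \<open>n\<close>, gives 1 / v, while the lower one gives 1 / (2
  n).\<close>

lemma w_hat_exp_le:
  fixes \<zeta> :: real
  assumes tr: "\<not> algebraic \<zeta>" and n: "1 \<le> n"
  shows "w_hat_exp n \<zeta> \<le> ereal (2 * real n)"
proof (rule ccontr)
  assume "\<not> w_hat_exp n \<zeta> \<le> ereal (2 * real n)"
  then obtain v where v: "2 * real n < v" "ereal v < w_hat_exp n \<zeta>"
    using ereal_dense2 by (metis ereal_less(2) ereal_less_ereal_Ex less_ereal.simps(1) not_le)
  have v0: "0 < v" using v(1) by linarith
  define N where "N = 2 * n - 1"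
  have N: "1 \<le> N" "real N = 2 * n - 1" using n by (auto simp: N_def of_nat_diff)
  have "ereal v < w_exp n \<zeta>" using v(2) w_hat_exp_le_w_exp[OF tr n] by (rule less_le_trans)
  then have "lambda_hat_exp N \<zeta> \<le> ereal (1 / v)"
    using lambda_hat_exp_le[OF tr N(1) _ v0 _ v(2), of n] n by (simp add: N_def)
  \<comment> \<open>Here the polynomial degree is \<open>N\<close> itself and u = N / 2, a value
    strictly below the Dirichlet exponent. The bound becomes 1 / (N + 1), which is exactly 1 / (2
    n).\<close>
  moreover have "ereal ((N + N / 2 - N) / (N / 2 * (real N - 1) + N)) \<le> lambda_hat_exp N \<zeta>"
  proof (rule lambda_hat_exp_ge)
    have "ereal (N / 2) < ereal N" using N by simp
    then show "ereal (N / 2) < w_hat_exp N \<zeta>" using w_hat_exp_ge[OF tr] by (rule less_le_trans)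
  qed (use N in auto)
  moreover have "(N + N / 2 - N) / (N / 2 * (real N - 1) + N) = 1 / (real N + 1)"
  proof -
    have "0 < real N + real N * real N" using N(1) by (intro add_pos_pos) auto
    then show ?thesis by (simp add: field_simps)
  qed
  ultimately have "ereal (1 / (real N + 1)) \<le> ereal (1 / v)" by (metis order_trans)
  then have "v \<le> real N + 1" using v0 by (simp add: field_simps)
  then show False using v(1) N by simp
qed

section \<open>Passage to the limit\<close>

lemma tendsto_floor_ratio:
  fixes x :: real
  assumes "0 \<le> x"
  shows "(\<lambda>k. real (nat \<lfloor>x * real k\<rfloor>) / real k) \<longlonglongrightarrow> x"
proof (rule tendsto_sandwich)
  show "\<forall>\<^sub>F k in sequentially. x - 1 / real k \<le> real (nat \<lfloor>x * real k\<rfloor>) / real k"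
    using eventually_gt_at_top[of 0]
  proof eventually_elim
    case (elim k)
    have "x * real k - 1 \<le> real (nat \<lfloor>x * real k\<rfloor>)" by linarith
    then have "(x * real k - 1) / real k \<le> real (nat \<lfloor>x * real k\<rfloor>) / real k"
      by (intro divide_right_mono) auto
    then show ?case using elim by (simp add: diff_divide_distrib)
  qed
  show "\<forall>\<^sub>F k in sequentially. real (nat \<lfloor>x * real k\<rfloor>) / real k \<le> x"
    using eventually_gt_at_top[of 0]
  proof eventually_elim
    case (elim k)
    have "0 \<le> x * real k" using assms by simp
    then have "real (nat \<lfloor>x * real k\<rfloor>) \<le> x * real k" by linarith
    then show ?case using elim by (simp add: field_simps)
  qed
  show "(\<lambda>k. x - 1 / real k) \<longlonglongrightarrow> x" by real_asymp
qed simp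

lemma filterlim_of_ratio:
  assumes "(\<lambda>k. real (f k) / real k) \<longlonglongrightarrow> c" "0 < c"
  shows "filterlim f at_top sequentially"
proof -
  have "filterlim (\<lambda>k. real (f k) / real k * real k) at_top sequentially"
    by (rule filterlim_tendsto_pos_mult_at_top[OF assms filterlim_real_sequentially])
  moreover have "\<forall>\<^sub>F k in sequentially. real (f k) / real k * real k = real (f k)"
    using eventually_gt_at_top[of 0] by eventually_elim simp
  ultimately have "filterlim (\<lambda>k. real (f k)) at_top sequentially"
    by (simp cong: filterlim_cong)
  then show ?thesis by (rule filterlim_sequentially_iff_filterlim_real[THEN iffD2])
qed

text \<open>Insert u = w n into \<open>lambda_hat_exp_ge\<close>; after multiplication by
  \<open>N\<close> the bound tends to t (1 + w - t) / w. The condition on \<open>w_hat_exp\<close>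
  stays inside the implication, so that it may hold eventually or only infinitely often.\<close>

lemma eventually_lambda_hat_ge:
  fixes \<zeta> w t c s :: real and n N :: "nat \<Rightarrow> nat"
  assumes w: "0 < w" and c: "0 < c" and t: "t < 1 + w" and s: "s < t * (1 + w - t) / w"
    and n: "(\<lambda>k. real (n k) / real k) \<longlonglongrightarrow> c" and N: "(\<lambda>k. real (N k) / real k) \<longlonglongrightarrow> t * c"
    and le: "\<And>k. n k \<le> N k"
  shows "\<forall>\<^sub>F k in sequentially. ereal (w * n k) < w_hat_exp (n k) \<zeta> \<longrightarrow>
           ereal s \<le> ereal (N k) * lambda_hat_exp (N k) \<zeta>"
proof -
  define q where "q k = real (N k) * ((n k + w * n k - N k) / (w * n k * (real (n k) - 1) + N k))" for k
  have lim1: "(\<lambda>k. (real (N k) / real k) * ((1 + w) * (real (n k) / real k) - real (N k) / real k) /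
      (w * (real (n k) / real k) * (real (n k) / real k - 1 / real k) + (real (N k) / real k) * (1 / real k)))
      \<longlonglongrightarrow> (t * c) * ((1 + w) * c - t * c) / (w * c * (c - 0) + t * c * 0)"
    using w c by (intro tendsto_intros n N lim_1_over_n) auto
  have "(t * c) * ((1 + w) * c - t * c) / (w * c * (c - 0) + t * c * 0) = t * (1 + w - t) / w"
    using c w by (simp add: field_simps)
  with order_tendstoD(1)[OF lim1, of s] s have
    "\<forall>\<^sub>F k in sequentially. s < (real (N k) / real k) * ((1 + w) * (real (n k) / real k) - real (N k) / real k) /
      (w * (real (n k) / real k) * (real (n k) / real k - 1 / real k) + (real (N k) / real k) * (1 / real k))"
    by simp
  then have ev1: "\<forall>\<^sub>F k in sequentially. s < q k"
    using eventually_gt_at_top[of 0]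
  proof eventually_elim
    case (elim k)
    have "(real (N k) / real k) * ((1 + w) * (real (n k) / real k) - real (N k) / real k)
       = (real (N k) * (n k + w * n k - N k)) / (real k)\<^sup>2"
      using elim(2) by (simp add: field_simps power2_eq_square)
    moreover have "w * (real (n k) / real k) * (real (n k) / real k - 1 / real k) + (real (N k) / real k) * (1 / real k)
       = (w * n k * (real (n k) - 1) + N k) / (real k)\<^sup>2"
      using elim(2) by (simp add: field_simps power2_eq_square)
    ultimately show ?case using elim by (simp add: q_def)
  qed
  have "(\<lambda>k. (1 + w) * (real (n k) / real k) - real (N k) / real k) \<longlonglongrightarrow> (1 + w) * c - t * c"
    by (intro tendsto_intros n N)
  moreover have "0 < (1 + w) * c - t * c" using t c by (simp flip: left_diff_distrib)
  ultimately have "\<forall>\<^sub>F k in sequentially. 0 < (1 + w) * (real (n k) / real k) - real (N k) / real k"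
    by (rule order_tendstoD)
  moreover have "\<forall>\<^sub>F k in sequentially. 0 < real (n k) / real k" using n c by (rule order_tendstoD)
  ultimately show ?thesis using ev1
  proof eventually_elim
    case (elim k)
    have k: "0 < real k" "0 < n k" using elim(2) by (auto simp: zero_less_divide_iff)
    have "real (N k) < n k + w * n k" using elim(1) k by (simp add: field_simps)
    then have "ereal (w * n k) < w_hat_exp (n k) \<zeta> \<longrightarrow>
       ereal ((n k + w * n k - N k) / (w * n k * (real (n k) - 1) + N k)) \<le> lambda_hat_exp (N k) \<zeta>"
      using k w le by (intro impI lambda_hat_exp_ge) auto
    then have "ereal (w * n k) < w_hat_exp (n k) \<zeta> \<longrightarrow> ereal (N k) *
       ereal ((n k + w * n k - N k) / (w * n k * (real (n k) - 1) + N k)) \<le> ereal (N k) * lambda_hat_exp (N k) \<zeta>"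
      by (intro impI ereal_mult_left_mono) auto
    then have "ereal (w * n k) < w_hat_exp (n k) \<zeta> \<longrightarrow> ereal (q k) \<le> ereal (N k) * lambda_hat_exp (N k) \<zeta>"
      by (simp add: q_def)
    moreover have "ereal s \<le> ereal (q k)" using elim(3) by simp
    ultimately show ?case using order_trans by blast
  qed
qed

text \<open>Insert v = min (w n) (y m) into \<open>lambda_hat_exp_le\<close>; N / v tends to e / min
  (w c) (y d).\<close>

lemma eventually_lambda_hat_le:
  fixes \<zeta> w y c d e s :: real and n m N :: "nat \<Rightarrow> nat"
  assumes tr: "\<not> algebraic \<zeta>"
    and pos: "0 < w" "0 < y" "0 < c" "0 < d" and s: "e / min (w * c) (y * d) < s"
    and n: "(\<lambda>k. real (n k) / real k) \<longlonglongrightarrow> c" and m: "(\<lambda>k. real (m k) / real k) \<longlonglongrightarrow> d"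
    and N: "(\<lambda>k. real (N k) / real k) \<longlonglongrightarrow> e" and le: "\<And>k. m k + n k \<le> N k + 1"
  shows "\<forall>\<^sub>F k in sequentially. ereal (w * n k) < w_hat_exp (n k) \<zeta> \<longrightarrow>
           ereal (y * m k) < w_exp (m k) \<zeta> \<longrightarrow> ereal (N k) * lambda_hat_exp (N k) \<zeta> < ereal s"
proof -
  have lim: "(\<lambda>k. (real (N k) / real k) / min (w * (real (n k) / real k)) (y * (real (m k) / real k)))
     \<longlonglongrightarrow> e / min (w * c) (y * d)"
    using pos by (intro tendsto_intros n m N) (auto simp: min_def)
  have "\<forall>\<^sub>F k in sequentially. 0 < real (n k) / real k" using n pos(3) by (rule order_tendstoD)
  moreover have "\<forall>\<^sub>F k in sequentially. 0 < real (m k) / real k" using m pos(4) by (rule order_tendstoD)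
  moreover note order_tendstoD(2)[OF lim s]
  ultimately show ?thesis
  proof eventually_elim
    case (elim k)
    have k: "0 < real k" "0 < n k" "0 < m k" using elim(1,2) by (auto simp: zero_less_divide_iff)
    define v where "v = min (w * n k) (y * m k)"
    have v: "0 < v" using k pos by (simp add: v_def)
    have "min (w * (real (n k) / real k)) (y * (real (m k) / real k)) = v / real k"
      using k by (simp add: v_def min_def field_simps)
    then have s': "real (N k) / v < s" using elim(3) k by simp
    show ?case
    proof (intro impI)
      assume "ereal (w * n k) < w_hat_exp (n k) \<zeta>" "ereal (y * m k) < w_exp (m k) \<zeta>"
      moreover have "ereal v \<le> ereal (w * n k)" "ereal v \<le> ereal (y * m k)" by (auto simp: v_def)
      ultimately have "ereal v < w_hat_exp (n k) \<zeta>" "ereal v < w_exp (m k) \<zeta>"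
        using le_less_trans by blast+
      then have "lambda_hat_exp (N k) \<zeta> \<le> ereal (1 / v)"
        using k le[of k] v by (intro lambda_hat_exp_le[OF tr, of _ "m k" "n k"]) auto
      then have "ereal (N k) * lambda_hat_exp (N k) \<zeta> \<le> ereal (N k) * ereal (1 / v)"
        by (intro ereal_mult_left_mono) auto
      also have "\<dots> < ereal s" using s' by simp
      finally show "ereal (N k) * lambda_hat_exp (N k) \<zeta> < ereal s" .
    qed
  qed
qed

lemma frequently_less_limsup:
  fixes f :: "nat \<Rightarrow> ereal"
  assumes "s < limsup f"
  shows "\<exists>\<^sub>F k in sequentially. s < f k"
proof (rule ccontr)
  assume "\<not> ?thesis"
  then have "\<forall>\<^sub>F k in sequentially. f k \<le> s" by (simp add: frequently_def not_less)
  then have "limsup f \<le> s" by (rule Limsup_bounded)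
  with assms show False by simp
qed

lemma limsup_ge_of_frequently:
  fixes f :: "nat \<Rightarrow> ereal"
  assumes g: "filterlim g at_top sequentially" and f: "\<exists>\<^sub>F k in sequentially. s \<le> f (g k)"
  shows "s \<le> limsup f"
proof (rule ccontr)
  assume "\<not> s \<le> limsup f"
  then have "\<forall>\<^sub>F N in sequentially. f N < s" by (intro Limsup_lessD) simp
  then have "\<forall>\<^sub>F k in sequentially. f (g k) < s" using g by (rule eventually_compose_filterlim)
  then show False using f by (auto simp: frequently_def not_le elim: eventually_mono)
qed

lemma liminf_le_of_frequently:
  fixes f :: "nat \<Rightarrow> ereal"
  assumes g: "filterlim g at_top sequentially" and f: "\<exists>\<^sub>F k in sequentially. f (g k) \<le> s"
  shows "liminf f \<le> s"
proof (rule ccontr)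
  assume "\<not> liminf f \<le> s"
  then have "\<forall>\<^sub>F N in sequentially. s < f N" by (intro less_LiminfD) simp
  then have "\<forall>\<^sub>F k in sequentially. s < f (g k)" using g by (rule eventually_compose_filterlim)
  then show False using f by (auto simp: frequently_def not_le elim: eventually_mono)
qed

lemma ereal_less_ratio:
  assumes "ereal w < a / ereal (real k)" "0 < k"
  shows "ereal (w * real k) < a"
  using assms by (cases a) (auto simp: field_simps)

lemma limsup_eq_real:
  fixes f :: "nat \<Rightarrow> ereal"
  assumes "\<And>n. 1 \<le> n \<Longrightarrow> ereal a \<le> f n" "\<And>n. 1 \<le> n \<Longrightarrow> f n \<le> ereal b"
  obtains u where "limsup f = ereal u" "a \<le> u" "u \<le> b"
proof -
  have ev: "\<forall>\<^sub>F n in sequentially. ereal a \<le> f n" "\<forall>\<^sub>F n in sequentially. f n \<le> ereal b"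
    by (rule eventually_sequentiallyI[of 1], use assms in blast)+
  have 1: "ereal a \<le> limsup f"
    using Liminf_bounded[OF ev(1)] Liminf_le_Limsup[of sequentially f] by simp
  have 2: "limsup f \<le> ereal b" using ev(2) by (rule Limsup_bounded)
  show ?thesis using 1 2 that by (cases "limsup f") auto
qed

lemma liminf_eq_real:
  fixes f :: "nat \<Rightarrow> ereal"
  assumes "\<And>n. 1 \<le> n \<Longrightarrow> ereal a \<le> f n" "\<And>n. 1 \<le> n \<Longrightarrow> f n \<le> ereal b"
  obtains u where "liminf f = ereal u" "a \<le> u" "u \<le> b"
proof -
  have ev: "\<forall>\<^sub>F n in sequentially. ereal a \<le> f n" "\<forall>\<^sub>F n in sequentially. f n \<le> ereal b"
    by (rule eventually_sequentiallyI[of 1], use assms in blast)+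
  have 1: "ereal a \<le> liminf f" using ev(1) by (rule Liminf_bounded)
  have 2: "liminf f \<le> ereal b"
    using Limsup_bounded[OF ev(2)] Liminf_le_Limsup[of sequentially f] by simp
  show ?thesis using 1 2 that by (cases "liminf f") auto
qed

section \<open>Optimising and letting the slopes tend to their limits\<close>

text \<open>The quadratic t (1 + u - t) / u is largest at t = (1 + u) / 2, with value (1 + u)^2 / (4
  u). Strict bounds for w < u pass to w = u by continuity.\<close>

lemma quotient_bound_by_continuity:
  fixes u :: real
  assumes u: "1 \<le> u"
    and bd: "\<And>w s t. \<lbrakk>0 < w; w < u; 1 \<le> t; t < 1 + w; s < t * (1 + w - t) / w\<rbrakk> \<Longrightarrow> ereal s \<le> x"
  shows "(ereal u + 1)\<^sup>2 / (4 * ereal u) \<le> x"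
proof -
  define t where "t = (1 + u) / 2"
  have "ereal (t * (1 + u - t) / u) \<le> x"
  proof (rule ereal_le_of_less)
    fix s assume s: "s < t * (1 + u - t) / u"
    have "((\<lambda>w. t * (1 + w - t) / w) \<longlongrightarrow> t * (1 + u - t) / u) (at_left u)"
      using u by (intro tendsto_intros) auto
    then have "\<forall>\<^sub>F w in at_left u. s < t * (1 + w - t) / w" using s by (rule order_tendstoD)
    moreover have "\<forall>\<^sub>F w in at_left u. w \<in> {max 0 (t - 1)<..<u}"
      using u by (intro eventually_at_leftI[of "max 0 (t - 1)"]) (auto simp: t_def)
    ultimately have "\<forall>\<^sub>F w in at_left u. ereal s \<le> x"
    proof eventually_elim
      case (elim w)
      then show ?case using u by (intro bd[of w t s]) (auto simp: t_def)
    qed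
    then show "ereal s \<le> x" by simp
  qed
  moreover have "t * (1 + u - t) / u = (u + 1)\<^sup>2 / (4 * u)"
    using u by (simp add: t_def field_simps power2_eq_square)
  moreover have "4 * ereal u = ereal (4 * u)"
    by (simp only: numeral_eq_ereal times_ereal.simps)
  ultimately show ?thesis using u by (simp add: one_ereal_def)
qed

text \<open>Setting w = y u leaves a single parameter, and (1 + y u) / (y (y u)) tends to 1 + 1 / u
  as \<open>y\<close> tends to 1.\<close>

lemma one_plus_inverse_bound_by_continuity:
  fixes u :: real
  assumes u: "1 \<le> u"
    and bd: "\<And>w y s. \<lbrakk>0 < w; w < u; 0 < y; y < 1; (1 + w) / (y * w) < s\<rbrakk> \<Longrightarrow> x \<le> ereal s"
  shows "x \<le> 1 + 1 / ereal u"
proof -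
  have "x \<le> ereal (1 + 1 / u)"
  proof (rule dense_ge)
    fix z assume z: "ereal (1 + 1 / u) < z"
    show "x \<le> z"
    proof (cases z)
      case (real s)
      have "((\<lambda>y. (1 + y * u) / (y * (y * u))) \<longlongrightarrow> (1 + 1 * u) / (1 * (1 * u))) (at_left 1)"
        using u by (intro tendsto_intros) auto
      moreover have "(1 + 1 * u) / (1 * (1 * u)) < s" using z real u by (simp add: field_simps)
      ultimately have "\<forall>\<^sub>F y in at_left 1. (1 + y * u) / (y * (y * u)) < s" by (rule order_tendstoD)
      moreover have "\<forall>\<^sub>F y in at_left (1::real). y \<in> {0<..<1}"
        by (intro eventually_at_leftI[of 0]) auto
      ultimately have "\<forall>\<^sub>F y in at_left (1::real). x \<le> ereal s"
      proof eventually_elim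
        case (elim y)
        then show ?case using u by (intro bd[of "y * u" y s]) auto
      qed
      then show ?thesis using real by simp
    qed (use z in auto)
  qed
  then show ?thesis using u by (simp add: one_ereal_def)
qed

text \<open>In the limit u (V - 1) \<le> V, that is u \<le> 1 + 1 / (V - 1), which is sharper than 1
  + 4 / V for large V. For small V the bound u \<le> 2 suffices.\<close>

lemma four_bound_by_continuity:
  fixes u :: real and W :: ereal
  assumes u: "u \<le> 2" "0 < u" and W: "1 \<le> W"
    and bd: "\<And>w y. \<lbrakk>0 < w; w < u; 1 < y; ereal y < W\<rbrakk> \<Longrightarrow> w \<le> 1 + w / y"
  shows "ereal u \<le> 1 + 4 / W"
proof -
  have bd': "u * (y - 1) \<le> y" if y: "1 < y" "ereal y < W" for y
  proof (rule tendsto_upperbound)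
    show "((\<lambda>w. w * (y - 1)) \<longlongrightarrow> u * (y - 1)) (at_left u)" by (intro tendsto_intros)
    have "\<forall>\<^sub>F w in at_left u. w \<in> {0<..<u}" using u by (intro eventually_at_leftI[of 0]) auto
    then show "\<forall>\<^sub>F w in at_left u. w * (y - 1) \<le> y"
      by eventually_elim (use bd y in \<open>auto simp: field_simps\<close>)
  qed simp
  show ?thesis
  proof (cases W)
    case (real V)
    have V: "1 \<le> V" using W real by simp
    have "u \<le> 1 + 4 / V"
    \<comment> \<open>At V = 4 / 3 the quantities 1 / (V - 1) and 4 / V coincide.\<close>
    proof (cases "V \<le> 4 / 3")
      case True
      then have "3 \<le> 4 / V" using V by (simp add: field_simps)
      then show ?thesis using u by linarith
    next
      case False
      have "u * (V - 1) \<le> V"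
      proof (rule tendsto_le)
        show "((\<lambda>y. u * (y - 1)) \<longlongrightarrow> u * (V - 1)) (at_left V)" by (intro tendsto_intros)
        show "((\<lambda>y. y) \<longlongrightarrow> V) (at_left V)" by (intro tendsto_intros)
        have "\<forall>\<^sub>F y in at_left V. y \<in> {1<..<V}" using False by (intro eventually_at_leftI[of 1]) auto
        then show "\<forall>\<^sub>F y in at_left V. u * (y - 1) \<le> y"
          by eventually_elim (use bd' real in auto)
      qed simp
      then have "u \<le> V / (V - 1)" using False by (simp add: field_simps)
      also have "\<dots> = 1 + 1 / (V - 1)" using False by (simp add: field_simps)
      also have "1 / (V - 1) \<le> 4 / V" using False by (simp add: field_simps)
      finally show ?thesis by simp
    qed
    then show ?thesis using real V by (simp add: one_ereal_def)
  next
    case PInf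
    have "u \<le> 1"
    proof (rule ccontr)
      assume "\<not> u \<le> 1"
      \<comment> \<open>Chosen so that y (u - 1) = 2 u, against the bound y (u - 1) \<le> u.\<close>
      define y where "y = 2 * u / (u - 1)"
      have "1 < y" using \<open>\<not> u \<le> 1\<close> by (simp add: y_def field_simps)
      then have "u * (y - 1) \<le> y" using bd' PInf by simp
      then have "y * (u - 1) \<le> u" by (simp add: algebra_simps)
      moreover have "y * (u - 1) = 2 * u" using \<open>\<not> u \<le> 1\<close> by (simp add: y_def)
      ultimately show False using u by simp
    qed
    then show ?thesis using PInf by (simp add: one_ereal_def)
  qed (use W in auto)
qed

text \<open>With m close to n w / y the products w n and y m balance. For N = n + m, asymptotically
  t n with t = 1 + w / y, the product of N and \<open>lambda_hat_exp N\<close> is asymptotically at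
  least t (1 + w - t) / w and at most t / w. If t < w these bounds contradict each other.\<close>

lemma w_hat_slope_le:
  fixes \<zeta> w y c :: real and n m :: "nat \<Rightarrow> nat"
  assumes tr: "\<not> algebraic \<zeta>" and pos: "0 < w" "1 < y" "0 < c"
    and n: "(\<lambda>k. real (n k) / real k) \<longlonglongrightarrow> c" and m: "(\<lambda>k. real (m k) / real k) \<longlonglongrightarrow> c * w / y"
    and freq: "\<exists>\<^sub>F k in sequentially. ereal (w * n k) < w_hat_exp (n k) \<zeta> \<and> ereal (y * m k) < w_exp (m k) \<zeta>"
  shows "w \<le> 1 + w / y"
proof (rule ccontr)
  assume "\<not> w \<le> 1 + w / y"
  define t where "t = 1 + w / y"
  have t: "0 < t" "t < 1 + w" "t < w"
    using pos \<open>\<not> w \<le> 1 + w / y\<close> by (auto simp: t_def field_simps intro: add_pos_pos)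
  have "t * 1 < t * (1 + w - t)" using t by (intro mult_strict_left_mono) auto
  then have "t / w < t * (1 + w - t) / w" using pos by (intro divide_strict_right_mono) auto
  then obtain s where s: "t / w < s" "s < t * (1 + w - t) / w" using dense by blast
  have N: "(\<lambda>k. real (n k + m k) / real k) \<longlonglongrightarrow> t * c"
  proof -
    have "(\<lambda>k. real (n k) / real k + real (m k) / real k) \<longlonglongrightarrow> c + c * w / y"
      by (intro tendsto_add n m)
    then show ?thesis by (simp add: t_def add_divide_distrib algebra_simps)
  qed
  have "min (w * c) (y * (c * w / y)) = w * c" using pos by simp
  then have s': "t * c / min (w * c) (y * (c * w / y)) < s" using s(1) pos by simp
  have "\<forall>\<^sub>F k in sequentially. ereal (w * n k) < w_hat_exp (n k) \<zeta> \<longrightarrow>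
           ereal s \<le> ereal (n k + m k) * lambda_hat_exp (n k + m k) \<zeta>"
    using eventually_lambda_hat_ge[OF pos(1) pos(3) t(2) s(2) n N] by simp
  moreover have "\<forall>\<^sub>F k in sequentially. ereal (w * n k) < w_hat_exp (n k) \<zeta> \<longrightarrow>
           ereal (y * m k) < w_exp (m k) \<zeta> \<longrightarrow> ereal (n k + m k) * lambda_hat_exp (n k + m k) \<zeta> < ereal s"
    using eventually_lambda_hat_le[OF tr pos(1) _ pos(3) _ s' n m N] pos by simp
  ultimately have "\<forall>\<^sub>F k in sequentially. \<not> (ereal (w * n k) < w_hat_exp (n k) \<zeta> \<and> ereal (y * m k) < w_exp (m k) \<zeta>)"
    by eventually_elim auto
  with freq show False by (simp add: frequently_def)
qed

theorem theorem3p8: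
  fixes \<zeta> :: real
  assumes "\<not> algebraic \<zeta>"
  shows "(w_hat_upper \<zeta> + 1)\<^sup>2 / (4 * w_hat_upper \<zeta>) \<le> lambda_hat_upper \<zeta>
       \<and> lambda_hat_upper \<zeta> \<le> 1 + 1 / w_hat_lower \<zeta>
       \<and> (w_hat_lower \<zeta> + 1)\<^sup>2 / (4 * w_hat_lower \<zeta>) \<le> lambda_hat_lower \<zeta>
       \<and> lambda_hat_lower \<zeta> \<le> 1 + 1 / w_hat_upper \<zeta>
       \<and> w_hat_upper \<zeta> \<le> Min {2, w_upper \<zeta>, 1 + 4 / w_lower \<zeta>}
       \<and> w_hat_lower \<zeta> \<le> Min {2, w_lower \<zeta>, 1 + 4 / w_upper \<zeta>}"
proof -
  note tr = assms
  \<comment> \<open>The ratios lie between 1 and 2, so both limits of the uniform exponents are real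
    numbers and continuity arguments apply.\<close>
  have lo: "ereal 1 \<le> w_hat_exp n \<zeta> / ereal (real n)" if "1 \<le> n" for n
    using w_hat_exp_ge[OF tr, of n] that by (cases "w_hat_exp n \<zeta>") (auto simp: field_simps)
  have hi: "w_hat_exp n \<zeta> / ereal (real n) \<le> ereal 2" if "1 \<le> n" for n
    using w_hat_exp_le[OF tr that] w_hat_exp_ge[OF tr, of n] that
    by (cases "w_hat_exp n \<zeta>") (auto simp: field_simps)
  obtain U where U: "w_hat_upper \<zeta> = ereal U" "1 \<le> U" "U \<le> 2"
    unfolding w_hat_upper_def by (rule limsup_eq_real[OF lo hi]) blast+
  obtain L where L: "w_hat_lower \<zeta> = ereal L" "1 \<le> L" "L \<le> 2"
    unfolding w_hat_lower_def by (rule liminf_eq_real[OF lo hi]) blast+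
  have pos: "\<forall>\<^sub>F k in sequentially. 0 < (k :: nat)" by (rule eventually_gt_at_top)
  have freqU: "\<exists>\<^sub>F k in sequentially. ereal (w * real k) < w_hat_exp k \<zeta>" if "w < U" for w
  proof -
    have "ereal w < limsup (\<lambda>n. w_hat_exp n \<zeta> / ereal (real n))"
      using that U(1) unfolding w_hat_upper_def by simp
    from frequently_less_limsup[OF this] show ?thesis
      by (rule frequently_rev_mp) (use pos in eventually_elim, auto intro: ereal_less_ratio)
  qed
  have evL: "\<forall>\<^sub>F k in sequentially. ereal (w * real k) < w_hat_exp k \<zeta>" if "w < L" for w
  proof -
    have "ereal w < liminf (\<lambda>n. w_hat_exp n \<zeta> / ereal (real n))"
      using that L(1) unfolding w_hat_lower_def by simp
    from less_LiminfD[OF this] pos show ?thesis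
      by eventually_elim (rule ereal_less_ratio)
  qed
  have freqW: "\<exists>\<^sub>F k in sequentially. ereal (y * real k) < w_exp k \<zeta>" if "ereal y < w_upper \<zeta>" for y
    using frequently_less_limsup[OF that[unfolded w_upper_def]]
    by (rule frequently_rev_mp) (use pos in eventually_elim, auto intro: ereal_less_ratio)
  have evW: "\<forall>\<^sub>F k in sequentially. ereal (y * real k) < w_exp k \<zeta>" if "ereal y < w_lower \<zeta>" for y
    using less_LiminfD[OF that[unfolded w_lower_def]] pos
    by eventually_elim (rule ereal_less_ratio)
  \<comment> \<open>Slopes below 1 are always available for \<open>w_exp\<close>; this supplies the
    irreducible polynomials for both upper bounds on the simultaneous exponents.\<close>
  have ev1: "\<forall>\<^sub>F k in sequentially. ereal (y * real k) < w_exp k \<zeta>" if "y < 1" for y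
    using pos
  proof eventually_elim
    case (elim k)
    then have "ereal (y * real k) < ereal (real k)" using that by simp
    also have "\<dots> \<le> w_hat_exp k \<zeta>" by (rule w_hat_exp_ge[OF tr])
    also have "\<dots> \<le> w_exp k \<zeta>" using elim by (intro w_hat_exp_le_w_exp[OF tr]) auto
    finally show ?case .
  qed
  have c1: "0 < (1 :: real)" by simp
  have id: "(\<lambda>k. real k / real k) \<longlonglongrightarrow> 1"
    by (rule tendsto_eventually, use pos in eventually_elim, simp)
  have ratio_le: "\<forall>\<^sub>F n in sequentially. w_hat_exp n \<zeta> / ereal (real n) \<le> w_exp n \<zeta> / ereal (real n)"
    using pos by eventually_elim (auto intro!: ereal_divide_right_mono w_hat_exp_le_w_exp[OF tr])
  have UW: "w_hat_upper \<zeta> \<le> w_upper \<zeta>"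
    unfolding w_hat_upper_def w_upper_def using ratio_le by (rule Limsup_mono)
  have LW: "w_hat_lower \<zeta> \<le> w_lower \<zeta>"
    unfolding w_hat_lower_def w_lower_def using ratio_le by (rule Liminf_mono)
  have W1: "1 \<le> w_lower \<zeta>" using order_trans[OF _ LW, of 1] L by simp
  have W2: "1 \<le> w_upper \<zeta>" using order_trans[OF _ UW, of 1] U by simp

  \<comment> \<open>A limsup needs only infinitely many N, so the good degrees k for
    \<open>w_hat_exp\<close> are used with N close to t k.\<close>
  have A: "(ereal U + 1)\<^sup>2 / (4 * ereal U) \<le> lambda_hat_upper \<zeta>"
  proof (rule quotient_bound_by_continuity[OF U(2)])
    fix w s t assume w: "0 < w" "w < U" and t: "1 \<le> t" "t < 1 + w" and s: "s < t * (1 + w - t) / w"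
    define N where "N k = nat \<lfloor>t * real k\<rfloor>" for k
    have N: "(\<lambda>k. real (N k) / real k) \<longlonglongrightarrow> t" unfolding N_def using t by (intro tendsto_floor_ratio) auto
    have le: "k \<le> N k" for k
    proof -
      have "1 * real k \<le> t * real k" using t by (intro mult_right_mono) auto
      then show ?thesis unfolding N_def by linarith
    qed
    have "\<forall>\<^sub>F k in sequentially. ereal (w * k) < w_hat_exp k \<zeta> \<longrightarrow>
           ereal s \<le> ereal (N k) * lambda_hat_exp (N k) \<zeta>"
      using eventually_lambda_hat_ge[where n = "\<lambda>k. k", OF w(1) c1 t(2) s id, of N] N le by simp
    then have "\<exists>\<^sub>F k in sequentially. ereal s \<le> ereal (N k) * lambda_hat_exp (N k) \<zeta>"
      using freqU[OF w(2)] by (rule frequently_mp)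
    then show "ereal s \<le> lambda_hat_upper \<zeta>" unfolding lambda_hat_upper_def
      using filterlim_of_ratio[OF N] t by (intro limsup_ge_of_frequently[of N]) auto
  qed
  \<comment> \<open>A liminf must treat every large k as N, so the polynomial degree is taken close
    to k / t.\<close>
  have B: "(ereal L + 1)\<^sup>2 / (4 * ereal L) \<le> lambda_hat_lower \<zeta>"
  proof (rule quotient_bound_by_continuity[OF L(2)])
    fix w s t assume w: "0 < w" "w < L" and t: "1 \<le> t" "t < 1 + w" and s: "s < t * (1 + w - t) / w"
    define n where "n k = nat \<lfloor>1 / t * real k\<rfloor>" for k
    have n: "(\<lambda>k. real (n k) / real k) \<longlonglongrightarrow> 1 / t" unfolding n_def using t by (intro tendsto_floor_ratio) auto
    have le: "n k \<le> k" for k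
    proof -
      have "1 / t * real k \<le> 1 * real k" using t by (intro mult_right_mono) auto
      then show ?thesis unfolding n_def by linarith
    qed
    have lim: "filterlim n at_top sequentially" using filterlim_of_ratio[OF n] t by simp
    have "\<forall>\<^sub>F k in sequentially. ereal (w * n k) < w_hat_exp (n k) \<zeta> \<longrightarrow>
           ereal s \<le> ereal k * lambda_hat_exp k \<zeta>"
      using eventually_lambda_hat_ge[where N = "\<lambda>k. k", OF w(1) _ t(2) s n] t id le by simp
    moreover have "\<forall>\<^sub>F k in sequentially. ereal (w * n k) < w_hat_exp (n k) \<zeta>"
      using evL[OF w(2)] lim by (rule eventually_compose_filterlim)
    ultimately have "\<forall>\<^sub>F k in sequentially. ereal s \<le> ereal k * lambda_hat_exp k \<zeta>"
      by eventually_elim simp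
    then show "ereal s \<le> lambda_hat_lower \<zeta>" unfolding lambda_hat_lower_def by (rule Liminf_bounded)
  qed
  \<comment> \<open>Every large k is split into n and m in the ratio 1 to w, which balances w n
    against m up to the factor y < 1; rounding down keeps n + m \<le> k.\<close>
  have C: "lambda_hat_upper \<zeta> \<le> 1 + 1 / ereal L"
  proof (rule one_plus_inverse_bound_by_continuity[OF L(2)])
    fix w y s assume w: "0 < w" "w < L" and y: "0 < y" "y < 1" and s: "(1 + w) / (y * w) < s"
    define n where "n k = nat \<lfloor>1 / (1 + w) * real k\<rfloor>" for k
    define m where "m k = nat \<lfloor>w / (1 + w) * real k\<rfloor>" for k
    have n: "(\<lambda>k. real (n k) / real k) \<longlonglongrightarrow> 1 / (1 + w)" unfolding n_def using w by (intro tendsto_floor_ratio) auto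
    have m: "(\<lambda>k. real (m k) / real k) \<longlonglongrightarrow> w / (1 + w)" unfolding m_def using w by (intro tendsto_floor_ratio) auto
    have le: "m k + n k \<le> k + 1" for k
    proof -
      have nn: "0 \<le> 1 / (1 + w) * real k" "0 \<le> w / (1 + w) * real k" using w by auto
      have "1 / (1 + w) + w / (1 + w) = 1" using w by (simp flip: add_divide_distrib)
      then have "1 / (1 + w) * real k + w / (1 + w) * real k = real k" by (metis distrib_right mult_1)
      then show ?thesis unfolding n_def m_def using nn by linarith
    qed
    have "y * (w / (1 + w)) \<le> 1 * (w / (1 + w))" using w y by (intro mult_right_mono) auto
    then have "min (w * (1 / (1 + w))) (y * (w / (1 + w))) = y * w / (1 + w)" by (simp add: min_absorb2)
    then have s': "1 / min (w * (1 / (1 + w))) (y * (w / (1 + w))) < s" using s by simp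
    have "\<forall>\<^sub>F k in sequentially. ereal (w * n k) < w_hat_exp (n k) \<zeta> \<longrightarrow>
           ereal (y * m k) < w_exp (m k) \<zeta> \<longrightarrow> ereal k * lambda_hat_exp k \<zeta> < ereal s"
      using eventually_lambda_hat_le[where N = "\<lambda>k. k", OF tr w(1) y(1) _ _ s' n m id] w le by simp
    moreover have "\<forall>\<^sub>F k in sequentially. ereal (w * n k) < w_hat_exp (n k) \<zeta>"
      using filterlim_of_ratio[OF n] w by (intro eventually_compose_filterlim[OF evL[OF w(2)]]) auto
    moreover have "\<forall>\<^sub>F k in sequentially. ereal (y * m k) < w_exp (m k) \<zeta>"
      using filterlim_of_ratio[OF m] w by (intro eventually_compose_filterlim[OF ev1[OF y(2)]]) auto
    ultimately have "\<forall>\<^sub>F k in sequentially. ereal k * lambda_hat_exp k \<zeta> \<le> ereal s"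
      by eventually_elim auto
    then show "lambda_hat_upper \<zeta> \<le> ereal s" unfolding lambda_hat_upper_def by (rule Limsup_bounded)
  qed
  \<comment> \<open>The same balance, now along the infinitely many k where
    \<open>w_hat_exp k\<close> is large, with m close to w k and N = k + m.\<close>
  have D: "lambda_hat_lower \<zeta> \<le> 1 + 1 / ereal U"
  proof (rule one_plus_inverse_bound_by_continuity[OF U(2)])
    fix w y s assume w: "0 < w" "w < U" and y: "0 < y" "y < 1" and s: "(1 + w) / (y * w) < s"
    define m where "m k = nat \<lfloor>w * real k\<rfloor>" for k
    have m: "(\<lambda>k. real (m k) / real k) \<longlonglongrightarrow> w" unfolding m_def using w by (intro tendsto_floor_ratio) auto
    have N: "(\<lambda>k. real (k + m k) / real k) \<longlonglongrightarrow> 1 + w"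
      using tendsto_add[OF id m] by (simp add: add_divide_distrib)
    have "min (w * 1) (y * w) = y * w" using w y by (simp add: min_def)
    then have s': "(1 + w) / min (w * 1) (y * w) < s" using s by simp
    have "\<forall>\<^sub>F k in sequentially. ereal (w * k) < w_hat_exp k \<zeta> \<longrightarrow>
           ereal (y * m k) < w_exp (m k) \<zeta> \<longrightarrow> ereal (real (k + m k)) * lambda_hat_exp (k + m k) \<zeta> < ereal s"
      using eventually_lambda_hat_le[where n = "\<lambda>k. k", OF tr w(1) y(1) c1 w(1) s' id m N] by simp
    moreover have "\<forall>\<^sub>F k in sequentially. ereal (y * m k) < w_exp (m k) \<zeta>"
      using filterlim_of_ratio[OF m] w by (intro eventually_compose_filterlim[OF ev1[OF y(2)]]) auto
    ultimately have "\<forall>\<^sub>F k in sequentially. ereal (w * k) < w_hat_exp k \<zeta> \<longrightarrow>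
           ereal (real (k + m k)) * lambda_hat_exp (k + m k) \<zeta> \<le> ereal s"
      by eventually_elim auto
    then have "\<exists>\<^sub>F k in sequentially. ereal (real (k + m k)) * lambda_hat_exp (k + m k) \<zeta> \<le> ereal s"
      using freqU[OF w(2)] by (rule frequently_mp)
    then show "lambda_hat_lower \<zeta> \<le> ereal s" unfolding lambda_hat_lower_def
      using filterlim_of_ratio[OF N] w by (intro liminf_le_of_frequently[of "\<lambda>k. k + m k"]) auto
  qed
  \<comment> \<open>The uniform slope holds infinitely often at degree k, the ordinary slope at all
    large degrees and hence at the matching m.\<close>
  have E: "ereal U \<le> 1 + 4 / w_lower \<zeta>"
  proof (rule four_bound_by_continuity[OF U(3) _ W1])
    fix w y assume w: "0 < w" "w < U" and y: "1 < y" "ereal y < w_lower \<zeta>"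
    define m where "m k = nat \<lfloor>1 * w / y * real k\<rfloor>" for k
    have m: "(\<lambda>k. real (m k) / real k) \<longlonglongrightarrow> 1 * w / y" unfolding m_def using w y by (intro tendsto_floor_ratio) auto
    have "\<forall>\<^sub>F k in sequentially. ereal (y * m k) < w_exp (m k) \<zeta>"
      using filterlim_of_ratio[OF m] w y by (intro eventually_compose_filterlim[OF evW[OF y(2)]]) auto
    with freqU[OF w(2)] have "\<exists>\<^sub>F k in sequentially. ereal (w * k) < w_hat_exp k \<zeta> \<and> ereal (y * m k) < w_exp (m k) \<zeta>"
      by (rule frequently_eventually_frequently)
    then show "w \<le> 1 + w / y" by (rule w_hat_slope_le[where n = "\<lambda>k. k", OF tr w(1) y(1) c1 id m])
  qed (use U in auto)
  \<comment> \<open>The roles are exchanged: the ordinary slope holds infinitely often at degree k,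
    and the degree n for the uniform exponent is matched to it.\<close>
  have F: "ereal L \<le> 1 + 4 / w_upper \<zeta>"
  proof (rule four_bound_by_continuity[OF L(3) _ W2])
    fix w y assume w: "0 < w" "w < L" and y: "1 < y" "ereal y < w_upper \<zeta>"
    define n where "n k = nat \<lfloor>y / w * real k\<rfloor>" for k
    have n: "(\<lambda>k. real (n k) / real k) \<longlonglongrightarrow> y / w" unfolding n_def using w y by (intro tendsto_floor_ratio) auto
    have m: "(\<lambda>k. real k / real k) \<longlonglongrightarrow> y / w * w / y" using id w y by simp
    have "\<forall>\<^sub>F k in sequentially. ereal (w * n k) < w_hat_exp (n k) \<zeta>"
      using filterlim_of_ratio[OF n] w y by (intro eventually_compose_filterlim[OF evL[OF w(2)]]) auto
    with freqW[OF y(2)] have "\<exists>\<^sub>F k in sequentially. ereal (y * k) < w_exp k \<zeta> \<and> ereal (w * n k) < w_hat_exp (n k) \<zeta>"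
      by (rule frequently_eventually_frequently)
    then have "\<exists>\<^sub>F k in sequentially. ereal (w * n k) < w_hat_exp (n k) \<zeta> \<and> ereal (y * k) < w_exp k \<zeta>"
      by (simp add: conj_commute)
    then show "w \<le> 1 + w / y" using w y by (intro w_hat_slope_le[where m = "\<lambda>k. k", OF tr w(1) y(1) _ n m]) auto
  qed (use L in auto)
  have two: "ereal U \<le> 2" "ereal L \<le> 2" using U(3) L(3) by simp_all
  show ?thesis using A B C D E F two UW LW unfolding U(1) L(1) by simp
qed

end
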